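(* Let $\mathcal{H}$ be a finite set of graphs. Then $\mathcal{H}$ is tasselled if and only if $\mathcal{H}$ is hassled.
   Context: All graphs are finite and simple; $G$ contains $H$ if $H$ is isomorphic to an induced subgraph of $G$; $G$ is $(K_{t+1},K_{t,t})$-free if it contains neither. A strand is a path $P$ plus a new vertex $x$ (neck) with at least one neighbor in $P$; a $c$-strand additionally has $x$ non-adjacent to the first $c$ and last $c$ vertices of $P$. A $c$-tassel is obtained from at least $c$ pairwise disjoint copies of a single $c$-strand by identifying their necks. $\mathcal{H}$ is tasselled if there is $c\in\mathbb{N}$ such that for every $c$-tassel $T$ there is $H\in\mathcal{H}$ with $T$ containing each component of $H$. A walk is a graph $W$ together with $n_W\in\mathbb{N}$ and a surjection $\varphi_W:\{1,\dots,n_W\}\to V(W)$ with $\varphi_W(i)\varphi_W(i+1)\in E(W)$ for all $i<n_W$; its first $c$ vertices are $\varphi_W(\{1,\dots,c\})$ and its last $c$ vertices are $\varphi_W(\{n_W-c+1,\dots,n_W\})$. A $c$-segment is a set of at most $c$ consecutive integers. $W$ is $c$-stretched if for every $c$-segment $S\subseteq\{1,\dots,n_W\}$, the induced subgraph $W[\varphi_W(S)]$ is a path. A $c$-hassle is a graph obtained from at least $c$ pairwise disjoint $c$-stretched walks (its walks) by adding arbitrary edges between different walks and then adding a vertex $x$ (the neck) that has a neighbor in each walk and is non-adjacent to the first $c$ and last $c$ vertices of each walk. $\mathcal{H}$ is hassled if for every $t\in\mathbb{N}$ there is $c=c(\mathcal{H},t)$ such that for every $(K_{t+1},K_{t,t})$-free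 $c$-hassle $T$ there exists $H\in\mathcal{H}$ such that $T$ contains every component of $H$.
   Formalization: "c-stretched" additionally requires φ_W to be injective on each c-segment S (the walk traverses the path W[φ_W(S)]); without this, oscillating walks on a 3-vertex path make {P_20} tasselled but not hassled. Host graphs T are taken, up to isomorphism, on natural numbers. *)

theory Defs
  imports "Graph_Theory.Graph_Theory"
begin

text \<open>
  A finite simple graph is a symmetric loop-free digraph without parallel arcs, i.e. some
  \<open>G :: 'a pair_pre_digraph\<close> with \<^term>\<open>pair_graph G\<close>; the undirected edge \<open>uv\<close> is the pair of
  arcs \<open>(u, v)\<close> and \<open>(v, u)\<close>. For such graphs the strongly connected components
  \<^term>\<open>pre_digraph.sccs (with_proj G)\<close> are the usual connected components, as induced subgraphs.
\<close>

definition contains :: "('a, 'b) pre_digraph \<Rightarrow> ('c, 'd) pre_digraph \<Rightarrow> bool" where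
  "contains G H \<longleftrightarrow> (\<exists>K. induced_subgraph K G \<and> digraph_iso H K)"

definition K_free :: "nat \<Rightarrow> 'a pair_pre_digraph \<Rightarrow> bool" where
  "K_free t G \<longleftrightarrow>
     \<not> (\<exists>K. induced_subgraph K (with_proj G) \<and> complete_digraph (t + 1) K) \<and>
     \<not> (\<exists>K. induced_subgraph K (with_proj G) \<and> complete_bipartite_digraph t t K)"

definition path_graph :: "'a list \<Rightarrow> 'a pair_pre_digraph" where
  "path_graph ps = \<lparr> pverts = set ps,
     parcs = {(ps ! i, ps ! j) | i j. i < length ps \<and> j < length ps \<and> (j = i + 1 \<or> i = j + 1)} \<rparr>"

definition is_path :: "('a, 'a \<times> 'a) pre_digraph \<Rightarrow> bool" where
  "is_path P \<longleftrightarrow> (\<exists>ps. ps \<noteq> [] \<and> distinct ps \<and> P = with_proj (path_graph ps))"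


subsection \<open>Strands and tassels\<close>

text \<open>\<open>ps\<close> lists the vertices of the path in order; \<open>x\<close> is the neck.\<close>

definition strand :: "'a pair_pre_digraph \<Rightarrow> 'a list \<Rightarrow> 'a \<Rightarrow> bool" where
  "strand S ps x \<longleftrightarrow> pair_graph S \<and> ps \<noteq> [] \<and> distinct ps \<and> x \<notin> set ps \<and>
     pverts S = insert x (set ps) \<and>
     with_proj S \<restriction> set ps = with_proj (path_graph ps) \<and>
     (\<exists>v \<in> set ps. (x, v) \<in> parcs S)"

definition c_strand :: "nat \<Rightarrow> 'a pair_pre_digraph \<Rightarrow> 'a list \<Rightarrow> 'a \<Rightarrow> bool" where
  "c_strand c S ps x \<longleftrightarrow> strand S ps x \<and>
     (\<forall>v \<in> set (take c ps) \<union> set (drop (length ps - c) ps). (x, v) \<notin> parcs S)"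

text \<open>
  The copies of the strand \<open>S\<close> are its images under the injections \<open>f i\<close> for \<open>i < m\<close>; they are
  glued at the common neck \<open>z\<close> and disjoint otherwise.
\<close>

definition c_tassel :: "nat \<Rightarrow> 'a pair_pre_digraph \<Rightarrow> bool" where
  "c_tassel c T \<longleftrightarrow> (\<exists>(S :: 'a pair_pre_digraph) ps x (m :: nat) (f :: nat \<Rightarrow> 'a \<Rightarrow> 'a) z.
     c_strand c S ps x \<and> c \<le> m \<and>
     (\<forall>i < m. inj_on (f i) (pverts S) \<and> f i x = z) \<and>
     (\<forall>i < m. \<forall>j < m. i \<noteq> j \<longrightarrow> f i ` pverts S \<inter> f j ` pverts S = {z}) \<and>
     pverts T = (\<Union>i < m. f i ` pverts S) \<and>
     parcs T = (\<Union>i < m. map_prod (f i) (f i) ` parcs S))"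

text \<open>
  Every finite graph has an isomorphic copy on natural numbers, so \<open>T\<close> ranges over all finite
  graphs up to isomorphism here and in \<open>hassled\<close> below.
\<close>

definition tasselled :: "'a pair_pre_digraph set \<Rightarrow> bool" where
  "tasselled \<H> \<longleftrightarrow> (\<exists>c. \<forall>T :: nat pair_pre_digraph. c_tassel c T \<longrightarrow>
     (\<exists>H \<in> \<H>. \<forall>C \<in> pre_digraph.sccs (with_proj H). contains (with_proj T) C))"


subsection \<open>Walks and hassles\<close>

definition is_walk :: "'a pair_pre_digraph \<Rightarrow> nat \<Rightarrow> (nat \<Rightarrow> 'a) \<Rightarrow> bool" where
  "is_walk W n \<phi> \<longleftrightarrow> pair_graph W \<and> \<phi> ` {1..n} = pverts W \<and>
     (\<forall>i. 1 \<le> i \<and> i < n \<longrightarrow> (\<phi> i, \<phi> (i + 1)) \<in> parcs W)"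

definition first_verts :: "nat \<Rightarrow> nat \<Rightarrow> (nat \<Rightarrow> 'a) \<Rightarrow> 'a set" where
  "first_verts c n \<phi> = \<phi> ` {i \<in> {1..n}. i \<le> c}"

definition last_verts :: "nat \<Rightarrow> nat \<Rightarrow> (nat \<Rightarrow> 'a) \<Rightarrow> 'a set" where
  "last_verts c n \<phi> = \<phi> ` {i \<in> {1..n}. n < i + c}"

definition c_segment :: "nat \<Rightarrow> nat set \<Rightarrow> bool" where
  "c_segment c S \<longleftrightarrow> (\<exists>a b. a \<le> b \<and> S = {a..b}) \<and> card S \<le> c"

text \<open>
  The path on \<open>\<phi> ` S\<close> is the one traversed by the walk, so \<open>\<phi>\<close> is injective on \<open>S\<close>. Without
  injectivity a walk could oscillate along an edge for arbitrarily long, e.g.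
  \<open>u, v, \<dots>, u, v, w, v, u, \<dots>, v, u\<close> on a three-vertex path, and be \<open>c\<close>-stretched for every \<open>c\<close>;
  hassles built from such walks contain no long induced path, while all \<open>c\<close>-tassels do for large \<open>c\<close>.
\<close>

definition c_stretched :: "nat \<Rightarrow> 'a pair_pre_digraph \<Rightarrow> nat \<Rightarrow> (nat \<Rightarrow> 'a) \<Rightarrow> bool" where
  "c_stretched c W n \<phi> \<longleftrightarrow> (\<forall>S. c_segment c S \<and> S \<subseteq> {1..n} \<longrightarrow>
     inj_on \<phi> S \<and> is_path (with_proj W \<restriction> (\<phi> ` S)))"

text \<open>
  As edges are only added between different walks, each walk \<open>W i\<close> is induced in \<open>T\<close>, and the
  edges of \<open>T\<close> between different walks are unconstrained.
\<close>

definition c_hassle :: "nat \<Rightarrow> 'a pair_pre_digraph \<Rightarrow> bool" where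
  "c_hassle c T \<longleftrightarrow> pair_graph T \<and>
     (\<exists>(m :: nat) (W :: nat \<Rightarrow> 'a pair_pre_digraph) (n :: nat \<Rightarrow> nat) (\<phi> :: nat \<Rightarrow> nat \<Rightarrow> 'a) x.
       c \<le> m \<and>
       (\<forall>i < m. is_walk (W i) (n i) (\<phi> i) \<and> c_stretched c (W i) (n i) (\<phi> i)) \<and>
       (\<forall>i < m. \<forall>j < m. i \<noteq> j \<longrightarrow> pverts (W i) \<inter> pverts (W j) = {}) \<and>
       (\<forall>i < m. x \<notin> pverts (W i)) \<and>
       pverts T = insert x (\<Union>i < m. pverts (W i)) \<and>
       (\<forall>i < m. with_proj T \<restriction> pverts (W i) = with_proj (W i)) \<and>
       (\<forall>i < m. \<exists>v \<in> pverts (W i). (x, v) \<in> parcs T) \<and>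
       (\<forall>i < m. \<forall>v \<in> first_verts c (n i) (\<phi> i) \<union> last_verts c (n i) (\<phi> i). (x, v) \<notin> parcs T))"

definition hassled :: "'a pair_pre_digraph set \<Rightarrow> bool" where
  "hassled \<H> \<longleftrightarrow> (\<forall>t. \<exists>c. \<forall>T :: nat pair_pre_digraph. c_hassle c T \<and> K_free t T \<longrightarrow>
     (\<exists>H \<in> \<H>. \<forall>C \<in> pre_digraph.sccs (with_proj H). contains (with_proj T) C))"

end

theory Submission
  imports Defs "HOL-Library.Ramsey"
begin

text \<open>
  Every tassel is a hassle, and it contains neither \<open>K\<^sub>4\<close> nor \<open>K\<^bsub>3,3\<^esub>\<close>, since deleting the neck leaves
  disjoint paths; so hassled families are tasselled.

  Conversely, let \<open>c\<close> witness that \<open>\<H>\<close> is tasselled and let \<open>h\<close> bound the orders of the graphs in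
  \<open>\<H>\<close>. Unrolling one walk of a hassle, and recording which of its positions are adjacent to the neck,
  yields a \<open>c\<close>-strand, hence a \<open>c\<close>-tassel, hence some \<open>H \<in> \<H>\<close>. Call the 0/1-words of length \<open>h\<close> read
  off along the walk its windows. By Ramsey's theorem and the exclusion of \<open>K\<^bsub>t+1\<^esub>\<close> and \<open>K\<^bsub>t,t\<^esub>\<close>, among
  many walks there are \<open>h\<close> with the same \<open>H\<close> and the same set of windows, and with pairwise
  anticomplete chosen occurrences of all these windows. At most \<open>h\<close> vertices of the tassel meet its
  paths in at most \<open>h\<close> runs of consecutive positions; placing each run into the matching window of
  a walk of its own embeds every component of \<open>H\<close> into the hassle.
\<close>

subsection \<open>Ramsey's theorem for anticomplete families\<close>

text \<open>The colouring need not be symmetric, so homogeneity is claimed only for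
  \<open>i < j\<close>. \<open>N\<close> is fixed before \<open>col\<close>, as the bound for
  hassles has to be chosen before the graph.\<close>

lemma ramsey_finite_colours:
  assumes "finite \<Omega>"
  shows "\<exists>N. \<forall>col :: nat \<Rightarrow> nat \<Rightarrow> 'c. (\<forall>i<N. \<forall>j<N. col i j \<in> \<Omega>) \<longrightarrow>
    (\<exists>X\<subseteq>{..<N}. card X = M \<and> (\<exists>k. \<forall>i\<in>X. \<forall>j\<in>X. i < j \<longrightarrow> col i j = k))"
proof -
  obtain e :: "'c \<Rightarrow> nat" where e: "bij_betw e \<Omega> {..<card \<Omega>}"
    using ex_bij_betw_finite_nat[OF assms] by (auto simp: atLeast0LessThan)
  obtain N :: nat where N: "partn_lst {..<N} (replicate (card \<Omega>) M) 2"
    using ramsey_full by blast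
  show ?thesis
  proof (intro exI[of _ N] allI impI)
    fix col :: "nat \<Rightarrow> nat \<Rightarrow> 'c"
    assume col: "\<forall>i<N. \<forall>j<N. col i j \<in> \<Omega>"
    \<comment> \<open>A 2-set is coloured by its increasing pair; \<open>e\<close> turns colours
      into the numbers that \<open>partn_lst\<close> works with.\<close>
    define f where "f S = e (col (Min S) (Max S))" for S
    have "f \<in> nsets {..<N} 2 \<rightarrow> {..<card \<Omega>}"
    proof
      fix S assume "S \<in> nsets {..<N} 2"
      then have "finite S" "S \<noteq> {}" "S \<subseteq> {..<N}" by (auto simp: nsets_def)
      then have "Min S < N" "Max S < N" using Min_in Max_in by blast+
      then show "f S \<in> {..<card \<Omega>}"
        using col e by (auto simp: f_def bij_betw_def)
    qed
    with N obtain k X where k: "k < card \<Omega>" and X: "X \<in> nsets {..<N} M"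
      and mono: "f ` nsets X 2 \<subseteq> {k}"
      by (auto simp: partn_lst_def monochromatic_def)
    have "col i j = inv_into \<Omega> e k" if "i \<in> X" "j \<in> X" "i < j" for i j
    proof -
      have "{i, j} \<in> nsets X 2" using that by auto
      then have "f {i, j} = k" using mono by blast
      then have "e (col i j) = k" using that by (simp add: f_def)
      moreover have "col i j \<in> \<Omega>" using col X that by (auto simp: nsets_def)
      ultimately show ?thesis using e by (auto simp: bij_betw_def)
    qed
    then show "\<exists>X\<subseteq>{..<N}. card X = M \<and> (\<exists>k. \<forall>i\<in>X. \<forall>j\<in>X. i < j \<longrightarrow> col i j = k)"
      using X by (auto simp: nsets_def)
  qed
qed

text \<open>Take the first \<open>a\<close> and the next \<open>b\<close> elements in increasing
  order. This provides the two sides of a biclique below.\<close>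

lemma split_finite_set:
  fixes X :: "'a :: linorder set"
  assumes "finite X" "a + b \<le> card X"
  obtains Y Z where "Y \<subseteq> X" "Z \<subseteq> X" "card Y = a" "card Z = b" "\<And>y z. y \<in> Y \<Longrightarrow> z \<in> Z \<Longrightarrow> y < z"
proof -
  define xs where "xs = sorted_list_of_set X"
  have xs: "set xs = X" "distinct xs" "length xs = card X" "sorted_wrt (<) xs"
    using assms(1) by (auto simp: xs_def)
  have "sorted_wrt (<) (take a xs @ drop a xs)" using xs(4) by simp
  then have "\<forall>y\<in>set (take a xs). \<forall>z\<in>set (drop a xs). y < z"
    unfolding sorted_wrt_append by blast
  moreover have "set (take b (drop a xs)) \<subseteq> set (drop a xs)" by (rule set_take_subset)
  moreover have "card (set (take a xs)) = a" "card (set (take b (drop a xs))) = b"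
    using xs assms(2) by (simp_all add: distinct_card)
  moreover have "set (take a xs) \<subseteq> X" "set (drop a xs) \<subseteq> X"
    using xs(1) set_take_subset set_drop_subset by metis+
  ultimately show ?thesis
    using that[of "set (take a xs)" "set (take b (drop a xs))"] by (meson subset_iff)
qed

text \<open>Colour \<open>i < j\<close> by the label of \<open>i\<close> and the set of all
  \<open>(p, q)\<close> with \<open>P i p\<close> adjacent to \<open>P j q\<close>. On a homogeneous
  set, a diagonal pair \<open>(p, p)\<close> in the common relation would yield a clique. Without
  diagonal pairs each family \<open>P i p\<close> with fixed \<open>p\<close> is stable, so any
  other pair would yield an induced biclique. \<open>N\<close> depends only on the index set, the
  labels, \<open>t\<close> and \<open>M\<close>.\<close>

lemma ramsey_anticomplete:
  assumes "finite I" "finite \<Sigma>"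
  obtains N where "\<And>(E :: 'v \<Rightarrow> 'v \<Rightarrow> bool) V (P :: nat \<Rightarrow> 'i \<Rightarrow> 'v) (\<sigma> :: nat \<Rightarrow> 's).
    symp E \<Longrightarrow>
    (\<And>i p. i < N \<Longrightarrow> p \<in> I \<Longrightarrow> P i p \<in> V) \<Longrightarrow>
    (\<And>i j p q. i < N \<Longrightarrow> j < N \<Longrightarrow> i \<noteq> j \<Longrightarrow> p \<in> I \<Longrightarrow> q \<in> I \<Longrightarrow> P i p \<noteq> P j q) \<Longrightarrow>
    (\<And>i. i < N \<Longrightarrow> \<sigma> i \<in> \<Sigma>) \<Longrightarrow>
    (\<And>U. U \<subseteq> V \<Longrightarrow> card U = t + 1 \<Longrightarrow> (\<And>u v. u \<in> U \<Longrightarrow> v \<in> U \<Longrightarrow> u \<noteq> v \<Longrightarrow> E u v) \<Longrightarrow> False) \<Longrightarrow>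
    (\<And>A B. A \<subseteq> V \<Longrightarrow> B \<subseteq> V \<Longrightarrow> A \<inter> B = {} \<Longrightarrow> card A = t \<Longrightarrow> card B = t \<Longrightarrow>
      (\<And>a b. a \<in> A \<Longrightarrow> b \<in> B \<Longrightarrow> E a b) \<Longrightarrow>
      (\<And>a b. a \<in> A \<Longrightarrow> b \<in> A \<Longrightarrow> a \<noteq> b \<Longrightarrow> \<not> E a b) \<Longrightarrow>
      (\<And>a b. a \<in> B \<Longrightarrow> b \<in> B \<Longrightarrow> a \<noteq> b \<Longrightarrow> \<not> E a b) \<Longrightarrow> False) \<Longrightarrow>
    \<exists>X\<subseteq>{..<N}. card X = M \<and> (\<forall>i\<in>X. \<forall>j\<in>X. \<sigma> i = \<sigma> j) \<and>
      (\<forall>i\<in>X. \<forall>j\<in>X. i \<noteq> j \<longrightarrow> (\<forall>p\<in>I. \<forall>q\<in>I. \<not> E (P i p) (P j q)))"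
proof -
  have "finite (\<Sigma> \<times> Pow (I \<times> I))" using assms by simp
  \<comment> \<open>The size suffices for each of three selections: \<open>t + 1\<close> indices for
    a clique, \<open>2 * t\<close> for a biclique, and \<open>M\<close> indices besides the largest
    one.\<close>
  from ramsey_finite_colours[OF this, of "M + 2 * t + 1"]
  obtain N where N: "\<And>col :: nat \<Rightarrow> nat \<Rightarrow> 's \<times> ('i \<times> 'i) set.
      (\<forall>i<N. \<forall>j<N. col i j \<in> \<Sigma> \<times> Pow (I \<times> I)) \<Longrightarrow>
      \<exists>X\<subseteq>{..<N}. card X = M + 2 * t + 1 \<and> (\<exists>k. \<forall>i\<in>X. \<forall>j\<in>X. i < j \<longrightarrow> col i j = k)"
    by blast
  show ?thesis
  proof (rule that[of N])
    fix E :: "'v \<Rightarrow> 'v \<Rightarrow> bool" and V and P :: "nat \<Rightarrow> 'i \<Rightarrow> 'v" and \<sigma> :: "nat \<Rightarrow> 's"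
    assume sym: "symp E"
      and inV: "\<And>i p. i < N \<Longrightarrow> p \<in> I \<Longrightarrow> P i p \<in> V"
      and dist: "\<And>i j p q. i < N \<Longrightarrow> j < N \<Longrightarrow> i \<noteq> j \<Longrightarrow> p \<in> I \<Longrightarrow> q \<in> I \<Longrightarrow> P i p \<noteq> P j q"
      and sig: "\<And>i. i < N \<Longrightarrow> \<sigma> i \<in> \<Sigma>"
      and no_clique: "\<And>U. U \<subseteq> V \<Longrightarrow> card U = t + 1 \<Longrightarrow>
        (\<And>u v. u \<in> U \<Longrightarrow> v \<in> U \<Longrightarrow> u \<noteq> v \<Longrightarrow> E u v) \<Longrightarrow> False"
      and no_biclique: "\<And>A B. A \<subseteq> V \<Longrightarrow> B \<subseteq> V \<Longrightarrow> A \<inter> B = {} \<Longrightarrow> card A = t \<Longrightarrow> card B = t \<Longrightarrow>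
        (\<And>a b. a \<in> A \<Longrightarrow> b \<in> B \<Longrightarrow> E a b) \<Longrightarrow>
        (\<And>a b. a \<in> A \<Longrightarrow> b \<in> A \<Longrightarrow> a \<noteq> b \<Longrightarrow> \<not> E a b) \<Longrightarrow>
        (\<And>a b. a \<in> B \<Longrightarrow> b \<in> B \<Longrightarrow> a \<noteq> b \<Longrightarrow> \<not> E a b) \<Longrightarrow> False"
    define col where "col i j = (\<sigma> i, {(p, q) \<in> I \<times> I. E (P i p) (P j q)})" for i j
    have "\<forall>i<N. \<forall>j<N. col i j \<in> \<Sigma> \<times> Pow (I \<times> I)"
      using sig by (auto simp: col_def)
    from N[OF this] obtain X s A where X: "X \<subseteq> {..<N}" "card X = M + 2 * t + 1"
      and hom: "\<And>i j. i \<in> X \<Longrightarrow> j \<in> X \<Longrightarrow> i < j \<Longrightarrow> col i j = (s, A)"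
      by auto
    have finX: "finite X" using X(1) finite_subset by blast
    have E_iff: "E (P i p) (P j q) \<longleftrightarrow> (p, q) \<in> A" if "i \<in> X" "j \<in> X" "i < j" "p \<in> I" "q \<in> I" for i j p q
    proof -
      have "A = {(p, q) \<in> I \<times> I. E (P i p) (P j q)}" using hom[OF that(1-3)] by (simp add: col_def)
      then show ?thesis using that by auto
    qed
    have inj: "inj_on (\<lambda>i. P i p) Y" if "Y \<subseteq> X" "p \<in> I" for Y p
      using dist X(1) that unfolding inj_on_def by (metis lessThan_iff subset_iff)
    \<comment> \<open>For equal positions the symmetry of \<open>E\<close> removes the restriction
      to \<open>i < j\<close>.\<close>
    have same: "E (P i p) (P j p) \<longleftrightarrow> (p, p) \<in> A" if "i \<in> X" "j \<in> X" "i \<noteq> j" "p \<in> I" for i j p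
      using that E_iff[of i j p p] E_iff[of j i p p] sym by (metis linorder_neqE_nat sympD)
    have diag: "(p, p) \<notin> A" if p: "p \<in> I" for p
    proof
      assume pp: "(p, p) \<in> A"
      obtain Y where Y: "Y \<subseteq> X" "card Y = t + 1"
        using obtain_subset_with_card_n[of "t + 1" X] X(2) by auto
      show False
      proof (rule no_clique)
        show "(\<lambda>i. P i p) ` Y \<subseteq> V" using inV Y(1) X(1) p by auto
        show "card ((\<lambda>i. P i p) ` Y) = t + 1"
          using inj[OF Y(1) p] Y(2) by (simp add: card_image)
        show "E u v" if "u \<in> (\<lambda>i. P i p) ` Y" "v \<in> (\<lambda>i. P i p) ` Y" "u \<noteq> v" for u v
          using that same pp p Y(1) by blast
      qed
    qed
    \<comment> \<open>The relation \<open>A\<close> describes pairs with the smaller index first,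
      which is why all of \<open>Y\<close> must lie below all of \<open>Z\<close>. Both sides are
      stable by \<open>diag\<close>.\<close>
    have A: "(p, q) \<notin> A" if p: "p \<in> I" and q: "q \<in> I" for p q
    proof
      assume pq: "(p, q) \<in> A"
      obtain Y Z where YZ: "Y \<subseteq> X" "Z \<subseteq> X" "card Y = t" "card Z = t"
        and less: "\<And>y z. y \<in> Y \<Longrightarrow> z \<in> Z \<Longrightarrow> y < z"
        using split_finite_set[OF finX, of t t] X(2) by auto
      let ?U = "(\<lambda>i. P i p) ` Y" and ?W = "(\<lambda>i. P i q) ` Z"
      show False
      proof (rule no_biclique)
        show "?U \<subseteq> V" "?W \<subseteq> V" using inV YZ X(1) p q by auto
        show "card ?U = t" "card ?W = t"
          using inj[OF YZ(1) p] inj[OF YZ(2) q] YZ(3,4) by (simp_all add: card_image)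
        have "P y p \<noteq> P z q" if "y \<in> Y" "z \<in> Z" for y z
        proof -
          have "y < N" "z < N" "y \<noteq> z" using that less[OF that] YZ X(1) by auto
          then show ?thesis using dist p q by blast
        qed
        then show "?U \<inter> ?W = {}" by blast
        show "E a b" if "a \<in> ?U" "b \<in> ?W" for a b
          using that E_iff less YZ pq p q by blast
        show "\<not> E a b" if "a \<in> ?U" "b \<in> ?U" "a \<noteq> b" for a b
          using that same diag YZ p by blast
        show "\<not> E a b" if "a \<in> ?W" "b \<in> ?W" "a \<noteq> b" for a b
          using that same diag YZ q by blast
      qed
    qed
    have "X \<noteq> {}" using X(2) by auto
    \<comment> \<open>A colour shows the label of the smaller index only. Dropping the largest index
      leaves indices whose labels can all be read off from their pair with
      \<open>Max X\<close>.\<close>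
    have "M \<le> card (X - {Max X})" using X(2) \<open>X \<noteq> {}\<close> finX by simp
    then obtain Y where Y: "Y \<subseteq> X - {Max X}" "card Y = M"
      using obtain_subset_with_card_n by metis
    have "\<sigma> i = s" if "i \<in> Y" for i
    proof -
      have "i \<in> X" "Max X \<in> X" "i < Max X"
        using that Y(1) finX \<open>X \<noteq> {}\<close> by (auto simp: less_le)
      then show ?thesis using hom[of i "Max X"] by (simp add: col_def)
    qed
    moreover have "\<not> E (P i p) (P j q)" if "i \<in> Y" "j \<in> Y" "i \<noteq> j" "p \<in> I" "q \<in> I" for i j p q
    proof -
      have "i \<in> X" "j \<in> X" using that Y by auto
      then show ?thesis
        using that E_iff[of i j p q] E_iff[of j i q p] A sym by (metis linorder_neqE_nat sympD)
    qed
    moreover have "Y \<subseteq> {..<N}" using Y(1) X(1) by blast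
    ultimately show "\<exists>X\<subseteq>{..<N}. card X = M \<and> (\<forall>i\<in>X. \<forall>j\<in>X. \<sigma> i = \<sigma> j) \<and>
      (\<forall>i\<in>X. \<forall>j\<in>X. i \<noteq> j \<longrightarrow> (\<forall>p\<in>I. \<forall>q\<in>I. \<not> E (P i p) (P j q)))"
      using Y(2) by (intro exI[of _ Y]) simp
  qed
qed

subsection \<open>Induced subgraphs\<close>

text \<open>An induced copy of \<open>C\<close> in \<open>G\<close> is carried over to
  \<open>T\<close> along \<open>g\<close>. Only the order of \<open>C\<close> enters, so the
  components of the graphs in the family never have to be analysed.\<close>

lemma contains_transfer:
  assumes C: "contains (with_proj G) C" and fin: "finite (verts C)"
    and T: "pair_wf_digraph T"
    and emb: "\<And>V. V \<subseteq> pverts G \<Longrightarrow> finite V \<Longrightarrow> card V = card (verts C) \<Longrightarrow>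
      \<exists>g. inj_on g V \<and> g ` V \<subseteq> pverts T \<and> (\<forall>u\<in>V. \<forall>v\<in>V. (u, v) \<in> parcs G \<longleftrightarrow> (g u, g v) \<in> parcs T)"
  shows "contains (with_proj T) C"
proof -
  from C obtain K where K: "induced_subgraph K (with_proj G)" and iso: "digraph_iso C K"
    by (auto simp: contains_def)
  from iso obtain f where f: "pre_digraph.digraph_isomorphism C f" "K = app_iso f C"
    by (auto simp: digraph_iso_def)
  have card: "card (verts K) = card (verts C)" and finK: "finite (verts K)"
    using f fin by (auto simp: pre_digraph.digraph_isomorphism_def card_image)
  have wfK: "wf_digraph K" and tK: "tail K = fst" "head K = snd"
    and sub: "verts K \<subseteq> pverts G"
    and arcs: "arcs K = {e \<in> parcs G. fst e \<in> verts K \<and> snd e \<in> verts K}"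
    using K by (auto simp: induced_subgraph_def subgraph_def compatible_def)
  obtain g where g: "inj_on g (verts K)" "g ` verts K \<subseteq> pverts T"
      "\<And>u v. u \<in> verts K \<Longrightarrow> v \<in> verts K \<Longrightarrow> (u, v) \<in> parcs G \<longleftrightarrow> (g u, g v) \<in> parcs T"
    using emb[OF sub finK card] by blast
  \<comment> \<open>Arcs of \<open>K\<close> are pairs of vertices, so the vertex map determines the
    arc map.\<close>
  define hom where "hom = \<lparr> iso_verts = g, iso_arcs = map_prod g g, iso_head = snd, iso_tail = fst \<rparr>"
  have "arcs K \<subseteq> verts K \<times> verts K" using arcs by auto
  then have "inj_on (map_prod g g) (arcs K)"
    using map_prod_inj_on[OF g(1) g(1)] inj_on_subset by blast
  then have "pre_digraph.digraph_isomorphism K hom"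
    using wfK g(1) tK by (auto simp: pre_digraph.digraph_isomorphism_def hom_def)
  moreover have "map_prod g g ` arcs K = {e \<in> parcs T. fst e \<in> g ` verts K \<and> snd e \<in> g ` verts K}"
    using g(3) by (force simp: arcs)
  then have "app_iso hom K = with_proj T \<restriction> (g ` verts K)"
    by (simp add: app_iso_def hom_def induce_subgraph_def)
  ultimately have "digraph_iso K (with_proj T \<restriction> (g ` verts K))"
    by (auto simp: digraph_iso_def)
  moreover have "induced_subgraph (with_proj T \<restriction> (g ` verts K)) (with_proj T)"
    using g(2) T by (intro wf_digraph.induced_induce) (auto simp: wf_digraph_wp_iff)
  ultimately show ?thesis
    using digraph_iso_trans[OF iso] by (auto simp: contains_def)
qed

text \<open>With the next lemma this puts \<open>K_free\<close> into the vertex-set form expected by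
  \<open>ramsey_anticomplete\<close>.\<close>

lemma K_free_no_clique:
  assumes T: "pair_graph T" and free: "K_free t T"
    and U: "U \<subseteq> pverts T" "card U = t + 1"
      "\<And>u v. u \<in> U \<Longrightarrow> v \<in> U \<Longrightarrow> u \<noteq> v \<Longrightarrow> (u, v) \<in> parcs T"
  shows False
proof -
  interpret pair_graph T by fact
  define K where "K = \<lparr> pverts = U, parcs = {e \<in> parcs T. fst e \<in> U \<and> snd e \<in> U} \<rparr>"
  have K: "with_proj K = with_proj T \<restriction> U"
    by (simp add: K_def with_proj_def induce_subgraph_def)
  have "finite U" using U(2) card_ge_0_finite[of U] by simp
  moreover have "parcs K = {(u, v). (u, v) \<in> pverts K \<times> pverts K \<and> u \<noteq> v}"
    using U by (auto simp: K_def dest: pair_no_loops)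
  ultimately have "complete_digraph (t + 1) (with_proj K)"
    using U(2) unfolding complete_digraph_pair_def by (simp add: K_def)
  moreover have "induced_subgraph (with_proj K) (with_proj T)"
    unfolding K using U(1) by (intro induced_induce) simp
  ultimately show False using free by (auto simp: K_free_def)
qed

lemma K_free_no_biclique:
  assumes T: "pair_graph T" and free: "K_free t T"
    and AB: "A \<subseteq> pverts T" "B \<subseteq> pverts T" "A \<inter> B = {}" "card A = t" "card B = t"
    and E: "\<And>a b. a \<in> A \<Longrightarrow> b \<in> B \<Longrightarrow> (a, b) \<in> parcs T"
    and nA: "\<And>a b. a \<in> A \<Longrightarrow> b \<in> A \<Longrightarrow> a \<noteq> b \<Longrightarrow> (a, b) \<notin> parcs T"
    and nB: "\<And>a b. a \<in> B \<Longrightarrow> b \<in> B \<Longrightarrow> a \<noteq> b \<Longrightarrow> (a, b) \<notin> parcs T"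
  shows False
proof -
  interpret pair_graph T by fact
  define K where "K = \<lparr> pverts = A \<union> B, parcs = {e \<in> parcs T. fst e \<in> A \<union> B \<and> snd e \<in> A \<union> B} \<rparr>"
  have K: "with_proj K = with_proj T \<restriction> (A \<union> B)"
    by (simp add: K_def with_proj_def induce_subgraph_def)
  have "(b, a) \<in> parcs T" if "a \<in> A" "b \<in> B" for a b
    using E[OF that] pair_sym_arcs by (auto simp: symmetric_def dest: symD)
  moreover have "(a, b) \<notin> parcs T" if "a \<in> A \<and> b \<in> A \<or> a \<in> B \<and> b \<in> B" for a b
    using that nA nB pair_no_loops[of "(a, b)"] by (cases "a = b") auto
  ultimately have "parcs K = A \<times> B \<union> B \<times> A"
    using E by (auto simp: K_def)
  moreover have "finite (A \<union> B)"
    using AB(1,2) pair_finite_verts finite_subset by blast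
  ultimately have "complete_bipartite_digraph t t (with_proj K)"
    using AB(3-5) unfolding complete_bipartite_digraph_pair_def
    by (intro conjI exI[of _ A] exI[of _ B]) (simp_all add: K_def)
  moreover have "induced_subgraph (with_proj K) (with_proj T)"
    unfolding K using AB by (intro induced_induce) simp
  ultimately show False using free by (auto simp: K_free_def)
qed

subsection \<open>Paths and stretched walks\<close>

lemma path_graph_arc_iff:
  assumes "distinct ps" "k < length ps" "l < length ps"
  shows "(ps ! k, ps ! l) \<in> parcs (path_graph ps) \<longleftrightarrow> l = k + 1 \<or> k = l + 1"
  using assms by (auto simp: path_graph_def nth_eq_iff_index_eq)

lemma path_graph_arc_in_set:
  "(u, v) \<in> parcs (path_graph ps) \<Longrightarrow> u \<in> set ps \<and> v \<in> set ps"
  by (auto simp: path_graph_def)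

lemma pair_graph_path_graph:
  assumes "distinct ps"
  shows "pair_graph (path_graph ps)"
proof
  have "parcs (path_graph ps) \<subseteq> set ps \<times> set ps" by (auto simp: path_graph_def)
  then show "finite (parcs (path_graph ps))" by (rule finite_subset) simp
  show "symmetric (with_proj (path_graph ps))"
    by (auto simp: symmetric_def sym_def path_graph_def)
qed (use assms in \<open>auto simp: path_graph_def nth_eq_iff_index_eq\<close>)

lemma induce_path_graph_segment:
  assumes "distinct qs"
  shows "with_proj (path_graph qs) \<restriction> set (take l (drop k qs)) = with_proj (path_graph (take l (drop k qs)))"
proof -
  let ?rs = "take l (drop k qs)"
  have rs: "distinct ?rs" using assms by simp
  have nth: "?rs ! i = qs ! (k + i)" "k + i < length qs" if "i < length ?rs" for i
    using that by (auto simp: less_diff_conv add.commute)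
  have "(u, v) \<in> parcs (path_graph qs) \<and> u \<in> set ?rs \<and> v \<in> set ?rs \<longleftrightarrow> (u, v) \<in> parcs (path_graph ?rs)" (is "?L \<longleftrightarrow> ?R") for u v
  proof -
    have *: "(?rs ! i, ?rs ! j) \<in> parcs (path_graph qs) \<longleftrightarrow> (?rs ! i, ?rs ! j) \<in> parcs (path_graph ?rs)"
      if "i < length ?rs" "j < length ?rs" for i j
      using path_graph_arc_iff[OF rs that] path_graph_arc_iff[OF assms nth(2)[OF that(1)] nth(2)[OF that(2)]]
      by (simp only: nth(1)[OF that(1)] nth(1)[OF that(2)]) auto
    show ?thesis using * path_graph_arc_in_set[of u v ?rs] by (metis in_set_conv_nth)
  qed
  then have "{e \<in> parcs (path_graph qs). fst e \<in> set ?rs \<and> snd e \<in> set ?rs} = parcs (path_graph ?rs)"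
    unfolding set_eq_iff by (metis (mono_tags, lifting) mem_Collect_eq prod.collapse)
  moreover have "pverts (path_graph ?rs) = set ?rs" by (simp add: path_graph_def)
  ultimately show ?thesis
    by (simp add: induce_subgraph_def with_proj_def)
qed

text \<open>The right-hand side depends on the length alone; hence two paths of equal length have
  equally many arcs.\<close>

lemma card_parcs_path_graph:
  assumes "distinct ps"
  shows "card (parcs (path_graph ps)) =
    card {(i, j). i < length ps \<and> j < length ps \<and> (j = i + 1 \<or> i = j + 1)}" (is "_ = card ?D")
proof -
  have "parcs (path_graph ps) = map_prod (nth ps) (nth ps) ` ?D"
    by (force simp: path_graph_def)
  moreover have "inj_on (map_prod (nth ps) (nth ps)) ?D"
    using assms by (auto simp: inj_on_def nth_eq_iff_index_eq)
  ultimately show ?thesis by (simp add: card_image)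
qed

text \<open>Being stretched provides a path on the vertices of the window, but possibly listed in
  another order than the walk's. The path in walk order is a subgraph of it with equally many arcs,
  so both have the same arcs. Walk positions start at 1, hence the bound
  \<open>a + h \<le> n + 1\<close>.\<close>

lemma c_stretched_window:
  assumes walk: "is_walk W n \<phi>" and str: "c_stretched c W n \<phi>"
    and h: "h \<le> c" "1 \<le> a" "a + h \<le> n + 1" and kl: "k < h" "l < h"
  shows "\<phi> (a + k) = \<phi> (a + l) \<longleftrightarrow> k = l"
    and "(\<phi> (a + k), \<phi> (a + l)) \<in> parcs W \<longleftrightarrow> l = k + 1 \<or> k = l + 1"
proof -
  define S where "S = {a..a + h - 1}"
  have "card S = h" using kl by (simp add: S_def)
  moreover have "\<exists>a b. a \<le> b \<and> S = {a..b}"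
    using kl by (intro exI[of _ a] exI[of _ "a + h - 1"]) (simp add: S_def)
  ultimately have "c_segment c S" using h(1) by (simp add: c_segment_def)
  moreover have "S \<subseteq> {1..n}" using h kl by (auto simp: S_def)
  ultimately have inj: "inj_on \<phi> S" and path: "is_path (with_proj W \<restriction> (\<phi> ` S))"
    using str unfolding c_stretched_def by blast+
  have in_S: "a + j \<in> S" if "j < h" for j using that by (auto simp: S_def)
  show "\<phi> (a + k) = \<phi> (a + l) \<longleftrightarrow> k = l"
    using inj_on_eq_iff[OF inj in_S in_S] kl by simp
  obtain ps where ps: "distinct ps" "with_proj W \<restriction> (\<phi> ` S) = with_proj (path_graph ps)"
    using path by (auto simp: is_path_def)
  have "\<phi> ` S = set ps" using arg_cong[OF ps(2), of verts] by (simp add: path_graph_def)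
  then have len: "length ps = h"
    using distinct_card[OF ps(1)] card_image[OF inj] \<open>card S = h\<close> by simp
  have arcs: "{e \<in> parcs W. fst e \<in> \<phi> ` S \<and> snd e \<in> \<phi> ` S} = parcs (path_graph ps)"
    using arg_cong[OF ps(2), of arcs] by simp
  \<comment> \<open>\<open>qs\<close> lists the window in walk order, while \<open>ps\<close> is the
    unknown order of the induced path.\<close>
  define qs where "qs = map (\<lambda>j. \<phi> (a + j)) [0..<h]"
  have qs: "length qs = h" "\<And>j. j < h \<Longrightarrow> qs ! j = \<phi> (a + j)" by (simp_all add: qs_def)
  have "distinct qs"
    using inj_on_eq_iff[OF inj in_S in_S] by (auto simp: qs_def distinct_map inj_on_def)
  interpret W: pair_graph W using walk by (simp add: is_walk_def)
  have step: "(\<phi> (a + j), \<phi> (a + (j + 1))) \<in> parcs W" "(\<phi> (a + (j + 1)), \<phi> (a + j)) \<in> parcs W" if "j + 1 < h" for j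
  proof -
    have "1 \<le> a + j \<and> a + j < n" using h that by auto
    then show "(\<phi> (a + j), \<phi> (a + (j + 1))) \<in> parcs W"
      using walk unfolding is_walk_def by (metis add.assoc)
    then show "(\<phi> (a + (j + 1)), \<phi> (a + j)) \<in> parcs W"
      using W.pair_sym_arcs by (auto simp: symmetric_def dest: symD)
  qed
  have "parcs (path_graph qs) \<subseteq> parcs (path_graph ps)"
  proof (rule subrelI)
    fix u v assume "(u, v) \<in> parcs (path_graph qs)"
    then obtain i j where ij: "u = \<phi> (a + i)" "v = \<phi> (a + j)" "i < h" "j < h" "j = i + 1 \<or> i = j + 1"
      using qs by (auto simp: path_graph_def)
    then have "(u, v) \<in> parcs W" using step[of i] step[of j] by auto
    then show "(u, v) \<in> parcs (path_graph ps)"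
      unfolding arcs[symmetric] using ij in_S by auto
  qed
  moreover have "card (parcs (path_graph ps)) = card (parcs (path_graph qs))"
    using card_parcs_path_graph[OF ps(1)] card_parcs_path_graph[OF \<open>distinct qs\<close>] len qs(1) by simp
  moreover have "finite (parcs (path_graph ps))"
    using pair_graph_path_graph[OF ps(1)] by (simp add: pair_graph_def pair_digraph_def pair_fin_digraph.pair_finite_arcs)
  ultimately have "parcs (path_graph qs) = parcs (path_graph ps)"
    by (simp add: card_subset_eq)
  then have "(\<phi> (a + k), \<phi> (a + l)) \<in> parcs W \<longleftrightarrow> (qs ! k, qs ! l) \<in> parcs (path_graph qs)"
    using kl in_S qs by (simp add: arcs[symmetric])
  then show "(\<phi> (a + k), \<phi> (a + l)) \<in> parcs W \<longleftrightarrow> l = k + 1 \<or> k = l + 1"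
    using path_graph_arc_iff[OF \<open>distinct qs\<close>] qs kl by simp
qed

subsection \<open>Tassels\<close>

text \<open>Up to the names of its vertices, a tassel is given by the number \<open>m\<close> of its paths, their length
  \<open>n\<close> and the set \<open>A\<close> of positions (counted from 0) adjacent to the neck \<open>z\<close>; \<open>p i k\<close> is the vertex
  in position \<open>k\<close> of the \<open>i\<close>-th path.\<close>

locale tassel_shape =
  fixes m n :: nat and A :: "nat set" and p :: "nat \<Rightarrow> nat \<Rightarrow> 'a" and z :: 'a
    and T :: "'a pair_pre_digraph"
  assumes inj: "i < m \<Longrightarrow> j < m \<Longrightarrow> k < n \<Longrightarrow> l < n \<Longrightarrow> p i k = p j l \<Longrightarrow> i = j \<and> k = l"
    and neck: "i < m \<Longrightarrow> k < n \<Longrightarrow> p i k \<noteq> z"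
    and positions: "k \<in> A \<Longrightarrow> k < n"
    and verts: "pverts T = insert z {p i k | i k. i < m \<and> k < n}"
    and arcs: "parcs T =
      {(p i k, p i l) | i k l. i < m \<and> k < n \<and> l < n \<and> (l = k + 1 \<or> k = l + 1)} \<union>
      {(z, p i k) | i k. i < m \<and> k \<in> A} \<union> {(p i k, z) | i k. i < m \<and> k \<in> A}"
begin

section \<open>Adjacency and small complete subgraphs in tassels\<close>

lemma path_arc_iff:
  assumes "i < m" "j < m" "k < n" "l < n"
  shows "(p i k, p j l) \<in> parcs T \<longleftrightarrow> i = j \<and> (l = k + 1 \<or> k = l + 1)"
proof
  assume "(p i k, p j l) \<in> parcs T"
  then obtain i' k' l' where "p i k = p i' k'" "p j l = p i' l'" "i' < m" "k' < n" "l' < n"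
      "l' = k' + 1 \<or> k' = l' + 1"
    unfolding arcs using neck[OF assms(1,3)] neck[OF assms(2,4)]
    by auto
  then show "i = j \<and> (l = k + 1 \<or> k = l + 1)"
    using inj[of i i' k k'] inj[of j i' l l'] assms by simp
next
  assume "i = j \<and> (l = k + 1 \<or> k = l + 1)"
  then show "(p i k, p j l) \<in> parcs T" unfolding arcs using assms by blast
qed

lemma neck_arc_iff:
  assumes "i < m" "k < n"
  shows "(z, p i k) \<in> parcs T \<longleftrightarrow> k \<in> A" "(p i k, z) \<in> parcs T \<longleftrightarrow> k \<in> A"
proof -
  have *: "i' = i \<and> k' = k" if "p i k = p i' k'" "i' < m" "k' \<in> A" for i' k'
    using that assms inj[of i i' k k'] positions by simp
  have "k \<in> A" if "(z, p i k) \<in> parcs T \<or> (p i k, z) \<in> parcs T"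
    using that neck[OF assms] * unfolding arcs by (auto simp: neck neck[symmetric])
  moreover have "(z, p i k) \<in> parcs T \<and> (p i k, z) \<in> parcs T" if "k \<in> A"
    using that assms unfolding arcs by blast
  ultimately show "(z, p i k) \<in> parcs T \<longleftrightarrow> k \<in> A" "(p i k, z) \<in> parcs T \<longleftrightarrow> k \<in> A" by blast+
qed

lemma no_neck_loop: "(z, z) \<notin> parcs T"
  using neck positions unfolding arcs by force

lemma pair_graph_T: "pair_graph T"
proof
  have "{p i k | i k. i < m \<and> k < n} = case_prod p ` ({..<m} \<times> {..<n})" by auto
  then show fin: "finite (pverts T)" unfolding verts by simp
  have sub: "parcs T \<subseteq> pverts T \<times> pverts T"
    unfolding verts arcs by (auto dest!: positions)
  then show "finite (parcs T)" using fin finite_subset by blast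
  show "e \<in> parcs T \<Longrightarrow> fst e \<in> pverts T" "e \<in> parcs T \<Longrightarrow> snd e \<in> pverts T" for e
    using sub by auto
  show "symmetric (with_proj T)"
    unfolding symmetric_def sym_def with_proj_simps arcs by (intro allI impI, elim UnE) blast+
  have "(u, u) \<notin> parcs T" for u
  proof (cases "u \<in> pverts T \<and> u \<noteq> z")
    case True
    then obtain i k where "u = p i k" "i < m" "k < n" using verts by auto
    then show ?thesis using path_arc_iff[of i i k k] by simp
  next
    case False
    then show ?thesis using no_neck_loop sub by auto
  qed
  then show "e \<in> parcs T \<Longrightarrow> fst e \<noteq> snd e" for e by (metis prod.collapse)
qed

text \<open>Apart from the neck, only the predecessor and the successor on the same path can be
  neighbours.\<close>

lemma degree_le_2:
  assumes "u \<in> pverts T" "u \<noteq> z" "z \<notin> V" "\<And>v. v \<in> V \<Longrightarrow> v \<in> pverts T \<and> (u, v) \<in> parcs T"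
  shows "card V \<le> 2"
proof -
  obtain i k where u: "u = p i k" "i < m" "k < n"
    using assms(1,2) verts by auto
  \<comment> \<open>At the ends of a path one of the two listed elements is not a neighbour; only
    the inclusion matters.\<close>
  have "V \<subseteq> {p i (k + 1), p i (k - 1)}"
  proof
    fix v assume "v \<in> V"
    with assms(3,4) have "v \<in> pverts T" "v \<noteq> z" "(u, v) \<in> parcs T" by auto
    moreover from this obtain j l where v: "v = p j l" "j < m" "l < n"
      using verts by auto
    ultimately have "i = j" "l = k + 1 \<or> k = l + 1"
      using path_arc_iff[OF u(2) v(2) u(3) v(3)] u v by auto
    then show "v \<in> {p i (k + 1), p i (k - 1)}" using v by auto
  qed
  then have "card V \<le> card {p i (k + 1), p i (k - 1)}" by (intro card_mono) auto
  also have "\<dots> \<le> 2" by (simp add: card_insert_if)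
  finally show ?thesis .
qed

text \<open>The three vertices would lie on one path at positions pairwise differing by exactly 1,
  which is impossible.\<close>

lemma no_triangle:
  assumes "{a, b, c} \<subseteq> pverts T - {z}" "(a, b) \<in> parcs T" "(b, c) \<in> parcs T" "(a, c) \<in> parcs T"
  shows False
proof -
  have *: "\<exists>i k. u = p i k \<and> i < m \<and> k < n" if "u \<in> pverts T - {z}" for u
    using that verts by auto
  obtain i1 k1 i2 k2 i3 k3 where "a = p i1 k1" "i1 < m" "k1 < n" "b = p i2 k2" "i2 < m" "k2 < n"
      "c = p i3 k3" "i3 < m" "k3 < n"
    using *[of a] *[of b] *[of c] assms(1) by auto
  then show False
    using assms(2-4) path_arc_iff by auto
qed

lemma K_free_3: "K_free 3 T"
  unfolding K_free_def
proof (intro conjI notI)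
  assume "\<exists>K. induced_subgraph K (with_proj T) \<and> complete_digraph (3 + 1) K"
  then obtain K where K: "induced_subgraph K (with_proj T)" and comp: "complete_digraph 4 K"
    by auto
  have K_arcs: "arcs_ends K \<subseteq> parcs T" and K_verts: "verts K \<subseteq> pverts T"
    using K by (auto simp: induced_subgraph_def subgraph_def compatible_def arcs_ends_conv)
  have card: "card (verts K) = 4"
    and adj: "\<And>u v. u \<in> verts K \<Longrightarrow> v \<in> verts K \<Longrightarrow> u \<noteq> v \<Longrightarrow> (u, v) \<in> parcs T"
    using comp K_arcs by (auto simp: complete_digraph_def)
  \<comment> \<open>Removing the neck from a clique on four vertices leaves a triangle.\<close>
  have "3 \<le> card (verts K - {z})" using card by (simp add: card_Diff_singleton_if)
  then obtain U where U: "U \<subseteq> verts K - {z}" "card U = 3"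
    using obtain_subset_with_card_n by metis
  then obtain a b c where abc: "U = {a, b, c}" "a \<noteq> b" "b \<noteq> c" "a \<noteq> c" by (auto simp: card_3_iff)
  show False
    using no_triangle[of a b c] adj[of a b] adj[of b c] adj[of a c] U abc K_verts by auto
next
  assume "\<exists>K. induced_subgraph K (with_proj T) \<and> complete_bipartite_digraph 3 3 K"
  then obtain K where K: "induced_subgraph K (with_proj T)" and comp: "complete_bipartite_digraph 3 3 K"
    by auto
  have K_arcs: "arcs_ends K \<subseteq> parcs T" and K_verts: "verts K \<subseteq> pverts T"
    using K by (auto simp: induced_subgraph_def subgraph_def compatible_def arcs_ends_conv)
  obtain U V where UV: "verts K = U \<union> V" "U \<inter> V = {}" "card U = 3" "card V = 3"
      "arcs_ends K = U \<times> V \<union> V \<times> U"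
    using comp by (auto simp: complete_bipartite_digraph_def)
  \<comment> \<open>The neck lies on at most one side, so up to exchanging the sides
    \<open>V\<close> avoids it. Some vertex of \<open>U\<close> other than the neck then has three
    neighbours in \<open>V\<close>.\<close>
  have False if "z \<notin> V" "U \<union> V \<subseteq> pverts T" "U \<times> V \<subseteq> parcs T" "card U = 3" "card V = 3" for U V
  proof -
    have "U - {z} \<noteq> {}" using that(4) card_mono[of "{z}" U] by auto
    then obtain u where "u \<in> U" "u \<noteq> z" by auto
    then have "card V \<le> 2" using that by (intro degree_le_2[of u]) auto
    then show False using that by simp
  qed
  from this[of V U] this[of U V] show False using UV K_arcs K_verts by auto
qed

text \<open>Each path, traversed once from end to end, is a walk whose segments are subpaths. The
  condition \<open>margin\<close> says that no neighbour of the neck is among the first or last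
  \<open>c\<close> positions.\<close>

lemma c_hassle:
  assumes "c \<le> m" "A \<noteq> {}" and margin: "\<And>k. k \<in> A \<Longrightarrow> c \<le> k \<and> k + c < n"
  shows "c_hassle c T"
proof -
  define qs where "qs i = map (p i) [0..<n]" for i
  \<comment> \<open>Path positions count from 0 and walk positions from 1.\<close>
  define \<phi> where "\<phi> i k = p i (k - 1)" for i k
  have len: "length (qs i) = n" for i by (simp add: qs_def)
  have nth: "k < n \<Longrightarrow> qs i ! k = p i k" for i k by (simp add: qs_def)
  have set: "set (qs i) = {p i k | k. k < n}" for i by (auto simp: qs_def)
  have dist: "distinct (qs i)" if "i < m" for i
    using that inj by (auto simp: qs_def distinct_map inj_on_def)
  have path_verts: "pverts (path_graph (qs i)) = {p i k | k. k < n}" for i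
    by (simp add: path_graph_def set)
  have path_arcs: "parcs (path_graph (qs i)) = {(p i k, p i l) | k l. k < n \<and> l < n \<and> (l = k + 1 \<or> k = l + 1)}" for i
    unfolding path_graph_def len pair_pre_digraph.select_convs
    by (intro Collect_cong ex_cong1) (auto simp: nth)
  have walk: "is_walk (path_graph (qs i)) n (\<phi> i)" if "i < m" for i
    unfolding is_walk_def
  proof (intro conjI allI impI)
    show "pair_graph (path_graph (qs i))" using dist[OF that] by (rule pair_graph_path_graph)
    show "\<phi> i ` {1..n} = pverts (path_graph (qs i))"
    proof -
      have "\<phi> i ` {1..n} = \<phi> i ` Suc ` {..<n}" by (simp add: image_Suc_lessThan)
      also have "\<dots> = p i ` {..<n}" by (simp add: image_image \<phi>_def)
      finally show ?thesis unfolding path_verts by auto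
    qed
    show "(\<phi> i k, \<phi> i (k + 1)) \<in> parcs (path_graph (qs i))" if "1 \<le> k \<and> k < n" for k
      unfolding path_arcs \<phi>_def using that by force
  qed
  have stretched: "c_stretched c (path_graph (qs i)) n (\<phi> i)" if i: "i < m" for i
    unfolding c_stretched_def c_segment_def
  proof (intro allI impI, elim conjE exE)
    fix S a b assume S: "S \<subseteq> {1..n}" "a \<le> b" "S = {a..b}"
    then have ab: "1 \<le> a" "b \<le> n" by auto
    have inj_\<phi>: "inj_on (\<phi> i) S"
    proof (rule inj_onI)
      fix k l assume "k \<in> S" "l \<in> S" "\<phi> i k = \<phi> i l"
      then show "k = l" using inj[OF i i, of "k - 1" "l - 1"] ab S(3)
        by (auto simp: \<phi>_def) linarith
    qed
    \<comment> \<open>Walk positions \<open>a\<close> to \<open>b\<close> are the list indices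
      \<open>a - 1\<close> to \<open>b - 1\<close>.\<close>
    define rs where "rs = take (b + 1 - a) (drop (a - 1) (qs i))"
    have "length rs = b + 1 - a" using ab by (simp add: rs_def len)
    then have "set rs = {rs ! k | k. k < b + 1 - a}" by (simp add: set_conv_nth)
    also have "\<dots> = {p i (a - 1 + k) | k. k < b + 1 - a}"
      using ab S(2) by (intro Collect_cong ex_cong1) (auto simp: rs_def len nth)
    also have "\<dots> = \<phi> i ` S"
    proof -
      have "\<exists>k'\<in>{a..b}. p i (a - 1 + k) = p i (k' - 1)" if "k < b + 1 - a" for k
        using that ab by (intro bexI[of _ "a + k"]) auto
      moreover have "\<exists>k. p i (k' - 1) = p i (a - 1 + k) \<and> k < b + 1 - a" if "k' \<in> {a..b}" for k'
        using that ab by (intro exI[of _ "k' - a"]) auto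
      ultimately show ?thesis unfolding \<phi>_def S(3) by blast
    qed
    finally have rs: "\<phi> i ` S = set rs" by simp
    have "with_proj (path_graph (qs i)) \<restriction> (\<phi> i ` S) = with_proj (path_graph rs)"
      unfolding rs unfolding rs_def by (rule induce_path_graph_segment[OF dist[OF i]])
    moreover have "distinct rs" using dist[OF i] by (simp add: rs_def)
    moreover have "rs \<noteq> []" using rs S by auto
    ultimately show "inj_on (\<phi> i) S \<and> is_path (with_proj (path_graph (qs i)) \<restriction> (\<phi> i ` S))"
      using inj_\<phi> by (auto simp: is_path_def)
  qed
  have ind: "with_proj T \<restriction> pverts (path_graph (qs i)) = with_proj (path_graph (qs i))" if i: "i < m" for i
  proof -
    have "{e \<in> parcs T. fst e \<in> {p i k | k. k < n} \<and> snd e \<in> {p i k | k. k < n}} = parcs (path_graph (qs i))"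
      (is "?L = _")
    proof (intro equalityI subrelI)
      fix u v assume "(u, v) \<in> ?L"
      then obtain k l where "u = p i k" "v = p i l" "k < n" "l < n" "(u, v) \<in> parcs T" by auto
      then show "(u, v) \<in> parcs (path_graph (qs i))"
        using path_arc_iff[OF i i] unfolding path_arcs by blast
    next
      fix u v assume "(u, v) \<in> parcs (path_graph (qs i))"
      then obtain k l where "u = p i k" "v = p i l" "k < n" "l < n" "l = k + 1 \<or> k = l + 1"
        unfolding path_arcs by blast
      then show "(u, v) \<in> ?L" using path_arc_iff[OF i i] by auto
    qed
    then show ?thesis
      by (simp add: induce_subgraph_def with_proj_def path_verts)
  qed
  have nbr: "k - 1 \<in> A" if "(z, \<phi> i k) \<in> parcs T" "k \<in> {1..n}" "i < m" for i k
    using that neck_arc_iff(1)[of i "k - 1"] by (auto simp: \<phi>_def)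
  have hassle: "c \<le> m \<and>
       (\<forall>i < m. is_walk (path_graph (qs i)) n (\<phi> i) \<and> c_stretched c (path_graph (qs i)) n (\<phi> i)) \<and>
       (\<forall>i < m. \<forall>j < m. i \<noteq> j \<longrightarrow> pverts (path_graph (qs i)) \<inter> pverts (path_graph (qs j)) = {}) \<and>
       (\<forall>i < m. z \<notin> pverts (path_graph (qs i))) \<and>
       pverts T = insert z (\<Union>i < m. pverts (path_graph (qs i))) \<and>
       (\<forall>i < m. with_proj T \<restriction> pverts (path_graph (qs i)) = with_proj (path_graph (qs i))) \<and>
       (\<forall>i < m. \<exists>v \<in> pverts (path_graph (qs i)). (z, v) \<in> parcs T) \<and>
       (\<forall>i < m. \<forall>v \<in> first_verts c n (\<phi> i) \<union> last_verts c n (\<phi> i). (z, v) \<notin> parcs T)"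
  proof (intro conjI allI impI)
    fix i assume i: "i < m"
    show "\<exists>v \<in> pverts (path_graph (qs i)). (z, v) \<in> parcs T"
      using assms(2) positions neck_arc_iff(1)[OF i] unfolding path_verts by blast
    show "\<forall>v \<in> first_verts c n (\<phi> i) \<union> last_verts c n (\<phi> i). (z, v) \<notin> parcs T"
      using nbr[OF _ _ i] margin unfolding first_verts_def last_verts_def by fastforce
    show "z \<notin> pverts (path_graph (qs i))" using i neck unfolding path_verts by auto
    show "pverts (path_graph (qs i)) \<inter> pverts (path_graph (qs j)) = {}" if "j < m" "i \<noteq> j" for j
      using that i inj unfolding path_verts by auto
  next
    show "pverts T = insert z (\<Union>i < m. pverts (path_graph (qs i)))"
      unfolding path_verts verts by auto
  qed (use assms(1) walk stretched ind in auto)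
  show ?thesis
    unfolding c_hassle_def
    by (rule conjI[OF pair_graph_T], intro exI[of _ m] exI[of _ "\<lambda>i. path_graph (qs i)"]
      exI[of _ "\<lambda>i. n"] exI[of _ \<phi>] exI[of _ z], rule hassle)
qed

end

section \<open>Passing between tassels and their shapes\<close>

text \<open>\<open>A\<close> collects the positions on the strand adjacent to its neck, and
  \<open>p i k\<close> is the image of position \<open>k\<close> in copy \<open>i\<close>.
  Positivity of \<open>c\<close> guarantees a copy, without which \<open>T\<close> would lack the
  neck.\<close>

lemma c_tassel_shape:
  fixes T :: "'a pair_pre_digraph"
  assumes "c_tassel c T" "0 < c"
  obtains m n A p z where "tassel_shape m n A p z T" "c \<le> m" "A \<noteq> {}"
    "\<And>k. k \<in> A \<Longrightarrow> c \<le> k \<and> k + c < n"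
proof -
  from assms(1) obtain S :: "'a pair_pre_digraph" and ps x m f z
    where *: "c_strand c S ps x \<and> c \<le> m \<and>
     (\<forall>i < m. inj_on (f i) (pverts S) \<and> f i x = z) \<and>
     (\<forall>i < m. \<forall>j < m. i \<noteq> j \<longrightarrow> f i ` pverts S \<inter> f j ` pverts S = {z}) \<and>
     pverts T = (\<Union>i < m. f i ` pverts S) \<and>
     parcs T = (\<Union>i < m. map_prod (f i) (f i) ` parcs S)"
    unfolding c_tassel_def by (elim exE)
  then have S: "c_strand c S ps x" and m: "c \<le> m"
    and f: "\<And>i. i < m \<Longrightarrow> inj_on (f i) (pverts S) \<and> f i x = z"
    and T: "pverts T = (\<Union>i < m. f i ` pverts S)" "parcs T = (\<Union>i < m. map_prod (f i) (f i) ` parcs S)"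
    by simp_all
  have disj: "f i ` pverts S \<inter> f j ` pverts S = {z}" if "i < m" "j < m" "i \<noteq> j" for i j
    using * that by simp
  have ps: "pair_graph S" "distinct ps" "x \<notin> set ps" "pverts S = insert x (set ps)"
    and ind: "with_proj S \<restriction> set ps = with_proj (path_graph ps)"
    and ex: "\<exists>v \<in> set ps. (x, v) \<in> parcs S"
    and far: "\<And>v. v \<in> set (take c ps) \<union> set (drop (length ps - c) ps) \<Longrightarrow> (x, v) \<notin> parcs S"
    using S by (auto simp: c_strand_def strand_def)
  interpret S: pair_graph S by fact
  define n where "n = length ps"
  define A where "A = {k. k < n \<and> (x, ps ! k) \<in> parcs S}"
  define p where "p i k = f i (ps ! k)" for i k
  have "{e \<in> parcs S. fst e \<in> set ps \<and> snd e \<in> set ps} = parcs (path_graph ps)"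
    using arg_cong[OF ind, of arcs] by simp
  note path_arcs_eq = this[symmetric]
  have path_arcs: "(u, v) \<in> parcs S \<longleftrightarrow> (u, v) \<in> parcs (path_graph ps)"
    if "u \<in> set ps" "v \<in> set ps" for u v
    using that unfolding path_arcs_eq by simp
  have sym: "(u, v) \<in> parcs S \<longleftrightarrow> (v, u) \<in> parcs S" for u v
    using S.pair_sym_arcs by (auto simp: symmetric_def dest: symD)
  have arcsS: "parcs S = {(ps ! k, ps ! l) | k l. k < n \<and> l < n \<and> (l = k + 1 \<or> k = l + 1)} \<union>
      {(x, ps ! k) | k. k \<in> A} \<union> {(ps ! k, x) | k. k \<in> A}" (is "_ = ?R")
  proof (intro equalityI subrelI)
    fix u v assume uv: "(u, v) \<in> parcs S"
    then have "u \<in> insert x (set ps)" "v \<in> insert x (set ps)" "u \<noteq> v"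
      using S.wellformed'[OF uv] S.pair_no_loops[OF uv] ps(4) by auto
    then consider "u = x" "v \<in> set ps" | "v = x" "u \<in> set ps" | "u \<in> set ps" "v \<in> set ps" by auto
    then show "(u, v) \<in> ?R"
    proof cases
      case 1
      then show ?thesis using uv by (auto simp: A_def n_def in_set_conv_nth)
    next
      case 2
      then have "(x, u) \<in> parcs S" using uv sym by blast
      then show ?thesis using 2 by (auto simp: A_def n_def in_set_conv_nth)
    next
      case 3
      then have "(u, v) \<in> parcs (path_graph ps)" using uv path_arcs by blast
      then show ?thesis by (auto simp: path_graph_def n_def)
    qed
  next
    fix u v assume "(u, v) \<in> ?R"
    moreover have "(ps ! k, ps ! l) \<in> parcs S" if "k < n" "l < n" "l = k + 1 \<or> k = l + 1" for k l
      using that path_graph_arc_iff[OF ps(2), of k l] path_arcs by (auto simp: n_def)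
    ultimately show "(u, v) \<in> parcs S" using sym by (auto simp: A_def)
  qed
  have nthS: "ps ! k \<in> pverts S" "ps ! k \<noteq> x" if "k < n" for k
    using that ps by (auto simp: n_def)
  have "p i k \<noteq> z" if "i < m" "k < n" for i k
  proof -
    have "f i (ps ! k) \<noteq> f i x"
      using f[OF that(1)] nthS[OF that(2)] ps(4) by (auto simp: inj_on_def)
    then show ?thesis using f[OF that(1)] by (simp add: p_def)
  qed
  note neck = this
  have "i = j \<and> k = l" if "i < m" "j < m" "k < n" "l < n" "p i k = p j l" for i j k l
  proof -
    have "i = j"
    proof (rule ccontr)
      assume "i \<noteq> j"
      moreover have "p i k \<in> f i ` pverts S \<inter> f j ` pverts S"
        using nthS(1)[OF that(3)] nthS(1)[OF that(4)] that(5) unfolding p_def Int_iff by (metis imageI)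
      ultimately show False using disj[of i j] neck[of i k] that by auto
    qed
    moreover from this have "ps ! k = ps ! l"
      using that f[OF that(1)] nthS by (auto simp: p_def inj_on_def)
    ultimately show ?thesis using that ps(2) by (auto simp: n_def nth_eq_iff_index_eq)
  qed
  note inj = this
  have setps: "set ps = {ps ! k | k. k < n}" by (auto simp: n_def set_conv_nth)
  have "0 < m" using m assms(2) by simp
  have "pverts T = insert z {p i k | i k. i < m \<and> k < n}"
  proof -
    have "f i ` pverts S = insert z {p i k | k. k < n}" if "i < m" for i
      using f[OF that] unfolding ps(4) setps p_def by auto
    then show ?thesis using \<open>0 < m\<close> unfolding T(1) by auto
  qed
  moreover have "parcs T = {(p i k, p i l) | i k l. i < m \<and> k < n \<and> l < n \<and> (l = k + 1 \<or> k = l + 1)} \<union>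
       {(z, p i k) | i k. i < m \<and> k \<in> A} \<union> {(p i k, z) | i k. i < m \<and> k \<in> A}"
  proof -
    have "map_prod (f i) (f i) ` parcs S = {(p i k, p i l) | k l. k < n \<and> l < n \<and> (l = k + 1 \<or> k = l + 1)} \<union>
       {(z, p i k) | k. k \<in> A} \<union> {(p i k, z) | k. k \<in> A}" if "i < m" for i
    proof -
      have "map_prod (f i) (f i) ` {(ps ! k, ps ! l) | k l. P k l} = {(p i k, p i l) | k l. P k l}" for P
        by (force simp: p_def)
      moreover have "map_prod (f i) (f i) ` {(x, ps ! k) | k. k \<in> A} = {(z, p i k) | k. k \<in> A}"
        "map_prod (f i) (f i) ` {(ps ! k, x) | k. k \<in> A} = {(p i k, z) | k. k \<in> A}"
        using f[OF that] by (force simp: p_def)+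
      ultimately show ?thesis unfolding arcsS image_Un by simp
    qed
    then have "parcs T = (\<Union>i<m. {(p i k, p i l) | k l. k < n \<and> l < n \<and> (l = k + 1 \<or> k = l + 1)} \<union>
       {(z, p i k) | k. k \<in> A} \<union> {(p i k, z) | k. k \<in> A})"
      unfolding T(2) by simp
    then show ?thesis by blast
  qed
  ultimately have "tassel_shape m n A p z T"
    using neck inj by unfold_locales (auto simp: A_def)
  moreover have "A \<noteq> {}" using ex by (auto simp: A_def n_def in_set_conv_nth)
  moreover have "c \<le> k \<and> k + c < n" if "k \<in> A" for k
  proof (rule ccontr)
    assume "\<not> (c \<le> k \<and> k + c < n)"
    moreover have k: "k < length ps" using that by (simp add: A_def n_def)
    ultimately consider "k < c" | "length ps - c \<le> k" by (auto simp: n_def)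
    then have "ps ! k \<in> set (take c ps) \<union> set (drop (length ps - c) ps)"
    proof cases
      case 1
      then have "take c ps ! k = ps ! k" "k < length (take c ps)" using k by auto
      then show ?thesis by (metis UnI1 nth_mem)
    next
      case 2
      then have "drop (length ps - c) ps ! (k - (length ps - c)) = ps ! k"
        "k - (length ps - c) < length (drop (length ps - c) ps)" using k by auto
      then show ?thesis by (metis UnI2 nth_mem)
    qed
    then show False using far that by (auto simp: A_def)
  qed
  ultimately show ?thesis using m that by blast
qed

text \<open>A representative on \<open>nat\<close>, the vertex type in \<open>tasselled\<close>. The
  \<open>Suc\<close> keeps 0 free for the neck.\<close>

definition standard_tassel :: "nat \<Rightarrow> nat \<Rightarrow> nat set \<Rightarrow> nat pair_pre_digraph" where
  "standard_tassel m n A = (let p = \<lambda>i k. Suc (prod_encode (i, k)) in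
    \<lparr> pverts = insert 0 {p i k | i k. i < m \<and> k < n},
      parcs = {(p i k, p i l) | i k l. i < m \<and> k < n \<and> l < n \<and> (l = k + 1 \<or> k = l + 1)} \<union>
        {(0, p i k) | i k. i < m \<and> k \<in> A} \<union> {(p i k, 0) | i k. i < m \<and> k \<in> A} \<rparr>)"

lemma tassel_shape_standard_tassel:
  assumes "A \<subseteq> {..<n}"
  shows "tassel_shape m n A (\<lambda>i k. Suc (prod_encode (i, k))) 0 (standard_tassel m n A)"
  using assms by unfold_locales (auto simp: standard_tassel_def Let_def)

lemma c_tassel_standard_tassel:
  assumes "c \<le> m" "0 < m" "A \<noteq> {}" and margin: "\<And>k. k \<in> A \<Longrightarrow> c \<le> k \<and> k + c < n"
  shows "c_tassel c (standard_tassel m n A)"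
proof -
  define ps where "ps = map Suc [0..<n]"
  define S where "S = \<lparr> pverts = insert 0 (set ps),
    parcs = parcs (path_graph ps) \<union> {(0, Suc k) | k. k \<in> A} \<union> {(Suc k, 0) | k. k \<in> A} \<rparr>"
  \<comment> \<open>The model strand has neck 0 and path vertices 1 to \<open>n\<close>;
    \<open>f i\<close> fixes the neck and renames position \<open>k\<close> for copy
    \<open>i\<close>.\<close>
  define f :: "nat \<Rightarrow> nat \<Rightarrow> nat" where
    "f i v = (case v of 0 \<Rightarrow> 0 | Suc k \<Rightarrow> Suc (prod_encode (i, k)))" for i v
  have f_simps: "f i 0 = 0" "f i (Suc k) = Suc (prod_encode (i, k))" for i k by (simp_all add: f_def)
  have A: "k < n" if "k \<in> A" for k using margin[OF that] by simp
  have ps: "distinct ps" "length ps = n" "set ps = Suc ` {..<n}" "\<And>k. k < n \<Longrightarrow> ps ! k = Suc k"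
    by (simp_all add: ps_def distinct_map atLeast0LessThan)
  have path_arcs: "parcs (path_graph ps) = {(Suc k, Suc l) | k l. k < n \<and> l < n \<and> (l = k + 1 \<or> k = l + 1)}"
    unfolding path_graph_def ps(2) pair_pre_digraph.select_convs
    by (intro Collect_cong ex_cong1) (auto simp: ps(4))
  have "pair_graph S"
  proof
    show fin: "finite (pverts S)" by (simp add: S_def)
    have sub: "parcs S \<subseteq> pverts S \<times> pverts S"
      using A by (auto simp: S_def path_arcs ps(3))
    show "finite (parcs S)" using fin sub finite_subset by blast
    show "e \<in> parcs S \<Longrightarrow> fst e \<in> pverts S" "e \<in> parcs S \<Longrightarrow> snd e \<in> pverts S" for e
      using sub by auto
    show "e \<in> parcs S \<Longrightarrow> fst e \<noteq> snd e" for e by (auto simp: S_def path_arcs)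
    show "symmetric (with_proj S)" by (auto simp: symmetric_def sym_def S_def path_arcs)
  qed
  moreover have "with_proj S \<restriction> set ps = with_proj (path_graph ps)"
  proof -
    have "{e \<in> parcs S. fst e \<in> set ps \<and> snd e \<in> set ps} = parcs (path_graph ps)"
      by (auto simp: S_def path_arcs ps(3))
    moreover have "pverts (path_graph ps) = set ps" by (simp add: path_graph_def)
    ultimately show ?thesis by (simp add: induce_subgraph_def with_proj_def)
  qed
  moreover have "ps \<noteq> []" using A assms(3) ps(2) by force
  moreover have "\<exists>v\<in>set ps. (0, v) \<in> parcs S" using A assms(3) by (auto simp: S_def ps(3))
  moreover have "(0, v) \<notin> parcs S" if "v \<in> set (take c ps) \<union> set (drop (length ps - c) ps)" for v
  proof -
    from that obtain k where k: "v = Suc k" "k < n" "k < c \<or> n - c \<le> k"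
      by (auto simp: in_set_conv_nth ps)
    then have "k \<notin> A" using margin[of k] by auto
    then show ?thesis using k by (auto simp: S_def path_arcs)
  qed
  ultimately have "c_strand c S ps 0"
    using ps by (auto simp: c_strand_def strand_def S_def)
  moreover have "\<forall>i<m. inj_on (f i) (pverts S) \<and> f i 0 = 0"
    by (auto simp: f_def inj_on_def split: nat.splits)
  moreover have "\<forall>i<m. \<forall>j<m. i \<noteq> j \<longrightarrow> f i ` pverts S \<inter> f j ` pverts S = {0}"
    by (auto simp: S_def ps(3) f_simps)
  moreover have "pverts (standard_tassel m n A) = (\<Union>i<m. f i ` pverts S)"
  proof -
    have "f i ` pverts S = insert 0 {Suc (prod_encode (i, k)) | k. k < n}" for i
      by (auto simp: S_def ps(3) image_image f_simps)
    then show ?thesis using assms(2) by (auto simp: standard_tassel_def Let_def)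
  qed
  moreover have "parcs (standard_tassel m n A) = (\<Union>i<m. map_prod (f i) (f i) ` parcs S)"
  proof -
    define p where "p i k = Suc (prod_encode (i, k))" for i k
    have f_Suc: "f i (Suc k) = p i k" for i k by (simp add: f_simps p_def)
    have "map_prod (f i) (f i) ` parcs S =
        {(p i k, p i l) | k l. k < n \<and> l < n \<and> (l = k + 1 \<or> k = l + 1)} \<union>
        {(0, p i k) | k. k \<in> A} \<union> {(p i k, 0) | k. k \<in> A}" (is "_ = ?R i") for i
    proof -
      have "map_prod (f i) (f i) ` {(Suc k, Suc l) | k l. P k l} = {(p i k, p i l) | k l. P k l}" for P
        by (force simp: f_Suc)
      moreover have "map_prod (f i) (f i) ` {(0, Suc k) | k. k \<in> A} = {(0, p i k) | k. k \<in> A}"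
        "map_prod (f i) (f i) ` {(Suc k, 0) | k. k \<in> A} = {(p i k, 0) | k. k \<in> A}"
        by (force simp: f_Suc f_simps(1))+
      ultimately show ?thesis by (simp add: S_def path_arcs image_Un)
    qed
    then have "(\<Union>i<m. map_prod (f i) (f i) ` parcs S) = (\<Union>i<m. ?R i)" by (simp only:)
    also have "\<dots> =
        {(p i k, p i l) | i k l. i < m \<and> k < n \<and> l < n \<and> (l = k + 1 \<or> k = l + 1)} \<union>
        {(0, p i k) | i k. i < m \<and> k \<in> A} \<union> {(p i k, 0) | i k. i < m \<and> k \<in> A}"
      by blast
    also have "\<dots> = parcs (standard_tassel m n A)"
      unfolding p_def standard_tassel_def Let_def pair_pre_digraph.select_convs ..
    finally show ?thesis ..
  qed
  ultimately show ?thesis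
    unfolding c_tassel_def using assms(1)
    by (intro exI[of _ S] exI[of _ ps] exI[of _ 0] exI[of _ m] exI[of _ f] conjI)
qed

subsection \<open>Embedding pieces of tassels into hassles\<close>

text \<open>Every maximal run of \<open>V\<close> on a path of the tassel has at most \<open>h\<close> vertices and is sent into a
  window of \<open>h\<close> consecutive positions of a walk of its own. The start of the window is cut off at
  \<open>n - h\<close> so that the window does not overshoot the path; runs that then share a window are still
  mapped correctly.\<close>

lemma (in tassel_shape) embed_by_runs:
  fixes G :: "'b pair_pre_digraph" and Q :: "'i \<Rightarrow> nat \<Rightarrow> nat \<Rightarrow> 'b"
  assumes V: "V \<subseteq> pverts T" "finite V" "card V \<le> h"
    and h: "0 < h" "h \<le> n" and X: "finite X" "h \<le> card X"
    and x: "x \<in> pverts G" "(x, x) \<notin> parcs G"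
    and Q_verts: "\<And>i b k. i \<in> X \<Longrightarrow> b \<le> n - h \<Longrightarrow> k < h \<Longrightarrow> Q i b k \<in> pverts G - {x}"
    and Q_neck: "\<And>i b k. i \<in> X \<Longrightarrow> b \<le> n - h \<Longrightarrow> k < h \<Longrightarrow> (x, Q i b k) \<in> parcs G \<longleftrightarrow> b + k \<in> A"
      "\<And>i b k. i \<in> X \<Longrightarrow> b \<le> n - h \<Longrightarrow> k < h \<Longrightarrow> (Q i b k, x) \<in> parcs G \<longleftrightarrow> b + k \<in> A"
    and Q_inj: "\<And>i b k l. i \<in> X \<Longrightarrow> b \<le> n - h \<Longrightarrow> k < h \<Longrightarrow> l < h \<Longrightarrow> Q i b k = Q i b l \<longleftrightarrow> k = l"
    and Q_arc: "\<And>i b k l. i \<in> X \<Longrightarrow> b \<le> n - h \<Longrightarrow> k < h \<Longrightarrow> l < h \<Longrightarrow>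
      (Q i b k, Q i b l) \<in> parcs G \<longleftrightarrow> l = k + 1 \<or> k = l + 1"
    and Q_disj: "\<And>i j b b' k l. i \<in> X \<Longrightarrow> j \<in> X \<Longrightarrow> i \<noteq> j \<Longrightarrow> b \<le> n - h \<Longrightarrow> b' \<le> n - h \<Longrightarrow>
      k < h \<Longrightarrow> l < h \<Longrightarrow> Q i b k \<noteq> Q j b' l \<and> (Q i b k, Q j b' l) \<notin> parcs G"
  shows "\<exists>g. inj_on g V \<and> g ` V \<subseteq> pverts G \<and>
    (\<forall>u\<in>V. \<forall>v\<in>V. (u, v) \<in> parcs T \<longleftrightarrow> (g u, g v) \<in> parcs G)"
proof -
  \<comment> \<open>For \<open>p j a\<close> in \<open>V\<close>, this is the first position of the
    maximal run of \<open>V\<close> on path \<open>j\<close> that contains position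
    \<open>a\<close>.\<close>
  define run where "run j a = (LEAST b. b \<le> a \<and> (\<forall>t\<in>{b..a}. p j t \<in> V))" for j a
  have run: "run j a \<le> a \<and> (\<forall>t\<in>{run j a..a}. p j t \<in> V)" if "p j a \<in> V" for j a
    unfolding run_def by (rule LeastI[of _ a]) (use that in auto)
  have run_le: "run j a \<le> b" if "b \<le> a" "\<forall>t\<in>{b..a}. p j t \<in> V" for j a b
    unfolding run_def by (rule Least_le) (use that in auto)
  have run_Suc: "run j (a + 1) = run j a" if "p j a \<in> V" "p j (a + 1) \<in> V" for j a
  proof (rule antisym)
    have "\<forall>t\<in>{run j a..a + 1}. p j t \<in> V"
    proof
      fix t assume "t \<in> {run j a..a + 1}"
      then show "p j t \<in> V" using run[OF that(1)] that(2) by (cases "t = a + 1") auto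
    qed
    moreover have "run j a \<le> a" using run[OF that(1)] by blast
    ultimately show le: "run j (a + 1) \<le> run j a" by (intro run_le[of "run j a"]) simp_all
    show "run j a \<le> run j (a + 1)"
      using run[OF that(2)] le \<open>run j a \<le> a\<close> by (intro run_le[of "run j (a + 1)" a]) auto
  qed
  \<comment> \<open>A run consists of distinct vertices of \<open>V\<close>, hence of at most
    \<open>h\<close>.\<close>
  have run_short: "a < run j a + h" if "p j a \<in> V" "j < m" "a < n" for j a
  proof -
    have "inj_on (p j) {run j a..a}" using inj[OF that(2) that(2)] that(3) by (auto simp: inj_on_def)
    then have "card {run j a..a} = card (p j ` {run j a..a})" by (simp add: card_image)
    also have "\<dots> \<le> card V" using run[OF that(1)] V(2) by (intro card_mono) auto
    finally show ?thesis using V(3) run[OF that(1)] by simp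
  qed
  define start where "start j a = min (run j a) (n - h)" for j a
  \<comment> \<open>If the start is cut off at \<open>n - h\<close>, the offset is still below
    \<open>h\<close> because \<open>a < n\<close>.\<close>
  have start: "start j a \<le> a" "start j a \<le> n - h" "a - start j a < h"
    if "p j a \<in> V" "j < m" "a < n" for j a
    using run[OF that(1)] run_short[OF that] that(3) h unfolding start_def by auto
  define pos where "pos = inv_into ({..<m} \<times> {..<n}) (case_prod p)"
  have pos: "pos (p j a) = (j, a)" if "j < m" "a < n" for j a
  proof -
    have "inj_on (case_prod p) ({..<m} \<times> {..<n})" using inj by (auto simp: inj_on_def)
    then have "pos (case_prod p (j, a)) = (j, a)"
      unfolding pos_def using that by (intro inv_into_f_f) auto
    then show ?thesis by simp
  qed
  \<comment> \<open>The key of a path vertex is its path and window start. There are at most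
    \<open>card V\<close> keys, so an injection \<open>\<gamma>\<close> can give each key its own
    walk. The arbitrary key of \<open>z\<close> does not affect this count.\<close>
  define key where "key v = (case pos v of (j, a) \<Rightarrow> (j, start j a))" for v
  have "card (key ` V) \<le> card X" using card_image_le[OF V(2), of key] V(3) X(2) by simp
  then obtain \<gamma> where \<gamma>: "\<gamma> ` key ` V \<subseteq> X" "inj_on \<gamma> (key ` V)"
    using card_le_inj[of "key ` V" X] V(2) X(1) by blast
  define g where "g v = (if v = z then x else case pos v of (j, a) \<Rightarrow> Q (\<gamma> (j, start j a)) (start j a) (a - start j a))" for v
  have g_neck: "g z = x" by (simp add: g_def)
  have g_path: "g (p j a) = Q (\<gamma> (j, start j a)) (start j a) (a - start j a)" if "j < m" "a < n" for j a
    using neck[OF that] pos[OF that] by (simp add: g_def)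
  have \<gamma>_in: "\<gamma> (j, start j a) \<in> X" if "p j a \<in> V" "j < m" "a < n" for j a
  proof -
    have "key (p j a) = (j, start j a)" using pos that by (simp add: key_def)
    then show ?thesis using \<gamma>(1) that(1) by force
  qed
  have \<gamma>_eq: "\<gamma> (j, start j a) = \<gamma> (i, start i b) \<longleftrightarrow> j = i \<and> start j a = start i b"
    if "p j a \<in> V" "j < m" "a < n" "p i b \<in> V" "i < m" "b < n" for j a i b
  proof -
    have "key (p j a) = (j, start j a)" "key (p i b) = (i, start i b)"
      using pos that by (simp_all add: key_def)
    then show ?thesis
      using inj_on_eq_iff[OF \<gamma>(2) imageI[OF that(1)] imageI[OF that(4)]] by simp
  qed
  have g_path_neck: "g (p j a) \<in> pverts G - {x}" "(x, g (p j a)) \<in> parcs G \<longleftrightarrow> a \<in> A"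
      "(g (p j a), x) \<in> parcs G \<longleftrightarrow> a \<in> A" if "p j a \<in> V" "j < m" "a < n" for j a
    using Q_verts[OF \<gamma>_in[OF that] start(2,3)[OF that]] Q_neck[OF \<gamma>_in[OF that] start(2,3)[OF that]]
      start(1)[OF that] unfolding g_path[OF that(2,3)] by simp_all
  have g_path_path: "(g (p j a) = g (p i b) \<longrightarrow> p j a = p i b) \<and>
      ((p j a, p i b) \<in> parcs T \<longleftrightarrow> (g (p j a), g (p i b)) \<in> parcs G)"
    if ja: "p j a \<in> V" "j < m" "a < n" and ib: "p i b \<in> V" "i < m" "b < n" for j a i b
  \<comment> \<open>With equal keys both vertices go into one window, which reproduces adjacency on
    the path. With different keys they are not adjacent in \<open>T\<close>, since adjacent ones
    share a run by \<open>run_Suc\<close>; their images lie in different walks and are not adjacent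
    by \<open>Q_disj\<close>.\<close>
  proof (cases "j = i \<and> start j a = start i b")
    case True
    then have ij: "i = j" and st: "start i b = start j a" by auto
    note s = start[OF ja] start[OF ib, unfolded st]
    have "g (p j a) = Q (\<gamma> (j, start j a)) (start j a) (a - start j a)"
      "g (p i b) = Q (\<gamma> (j, start j a)) (start j a) (b - start j a)"
      using g_path[OF ja(2,3)] g_path[OF ib(2,3), unfolded st] ij by simp_all
    moreover have "a - start j a = b - start j a \<longleftrightarrow> a = b"
      "b - start j a = a - start j a + 1 \<longleftrightarrow> b = a + 1" "a - start j a = b - start j a + 1 \<longleftrightarrow> a = b + 1"
      using s by auto
    ultimately show ?thesis
      using Q_inj[OF \<gamma>_in[OF ja] s(2,3,6)] Q_arc[OF \<gamma>_in[OF ja] s(2,3,6)]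
        path_arc_iff[OF ja(2) ib(2) ja(3) ib(3)] ij by simp
  next
    case False
    have "\<not> (j = i \<and> (b = a + 1 \<or> a = b + 1))"
      using False run_Suc[of j a] run_Suc[of i b] ja ib unfolding start_def by auto
    moreover have "\<gamma> (j, start j a) \<noteq> \<gamma> (i, start i b)" using \<gamma>_eq[OF ja ib] False by blast
    ultimately show ?thesis
      using Q_disj[OF \<gamma>_in[OF ja] \<gamma>_in[OF ib] _ start(2)[OF ja] start(2)[OF ib] start(3)[OF ja] start(3)[OF ib]]
        path_arc_iff[OF ja(2) ib(2) ja(3) ib(3)] g_path ja ib by simp
  qed
  have V_cases: "v = z \<or> (\<exists>j a. v = p j a \<and> j < m \<and> a < n)" if "v \<in> V" for v
    using that V(1) verts by auto
  have *: "g u \<in> pverts G \<and> (g u = g v \<longrightarrow> u = v) \<and> ((u, v) \<in> parcs T \<longleftrightarrow> (g u, g v) \<in> parcs G)"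
    if u: "u \<in> V" and v: "v \<in> V" for u v
  proof -
    consider "u = z" "v = z" | j a where "u = z" "v = p j a" "j < m" "a < n"
      | j a where "v = z" "u = p j a" "j < m" "a < n"
      | j a i b where "u = p j a" "j < m" "a < n" "v = p i b" "i < m" "b < n"
      using V_cases[OF u] V_cases[OF v] by blast
    then show ?thesis
    proof cases
      case 1
      then show ?thesis using x no_neck_loop by (simp add: g_neck)
    next
      case 2
      then show ?thesis
        using g_path_neck[of j a] neck_arc_iff[of j a] v x by (auto simp: g_neck)
    next
      case 3
      then show ?thesis
        using g_path_neck[of j a] neck_arc_iff[of j a] u by (auto simp: g_neck)
    next
      case 4
      then show ?thesis using g_path_path[of j a i b] g_path_neck(1)[of j a] u v by simp
    qed
  qed
  show ?thesis
  proof (intro exI[of _ g] conjI ballI)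
    show "inj_on g V" using * by (auto simp: inj_on_def)
    show "g ` V \<subseteq> pverts G" using * by blast
  qed (use * in blast)
qed

section \<open>The two implications\<close>

lemma hassled_imp_tasselled:
  assumes "hassled \<H>"
  shows "tasselled \<H>"
proof -
  obtain c where c: "\<forall>T :: nat pair_pre_digraph. c_hassle c T \<and> K_free 3 T \<longrightarrow>
     (\<exists>H \<in> \<H>. \<forall>C \<in> pre_digraph.sccs (with_proj H). contains (with_proj T) C)"
    using assms unfolding hassled_def by blast
  show ?thesis
    unfolding tasselled_def
  \<comment> \<open>Using \<open>c + 1\<close> supplies the positive parameter that
    \<open>c_tassel_shape\<close> needs; such a tassel is also a \<open>c\<close>-hassle.\<close>
  proof (intro exI[of _ "c + 1"] allI impI)
    fix T :: "nat pair_pre_digraph" assume "c_tassel (c + 1) T"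
    then obtain m n A p z where shape: "tassel_shape m n A p z T" and m: "c + 1 \<le> m" and A: "A \<noteq> {}"
      and margin: "\<And>k. k \<in> A \<Longrightarrow> c + 1 \<le> k \<and> k + (c + 1) < n"
      by (rule c_tassel_shape) auto
    have "c_hassle c T"
    proof (rule tassel_shape.c_hassle[OF shape _ A])
      show "c \<le> k \<and> k + c < n" if "k \<in> A" for k using margin[OF that] by simp
    qed (use m in simp)
    then show "\<exists>H \<in> \<H>. \<forall>C \<in> pre_digraph.sccs (with_proj H). contains (with_proj T) C"
      using c tassel_shape.K_free_3[OF shape] by blast
  qed
qed

lemma tasselled_imp_hassled:
  fixes \<H> :: "'a pair_pre_digraph set"
  assumes fin: "finite \<H>" and graphs: "\<And>H. H \<in> \<H> \<Longrightarrow> pair_graph H" and "tasselled \<H>"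
  shows "hassled \<H>"
  unfolding hassled_def
proof
  fix t
  obtain c where c: "\<And>T :: nat pair_pre_digraph. c_tassel c T \<Longrightarrow>
     \<exists>H \<in> \<H>. \<forall>C \<in> pre_digraph.sccs (with_proj H). contains (with_proj T) C"
    using assms(3) unfolding tasselled_def by blast
  \<comment> \<open>The sum bounds the order of every member, and \<open>Suc\<close> makes the
    window length positive in all cases.\<close>
  define h where "h = Suc (\<Sum>H\<in>\<H>. card (pverts H))"
  have h: "card (pverts H) \<le> h" if "H \<in> \<H>" for H
    using member_le_sum[OF that, of "\<lambda>H. card (pverts H)"] fin by (simp add: h_def)
  have "0 < h" by (simp add: h_def)
  define words where "words = {w :: bool list. length w = h}"
  have "finite words"
    using finite_lists_length_eq[of "UNIV :: bool set" h] by (simp add: words_def)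
  then have "finite (words \<times> {..<h})" "finite (\<H> \<times> Pow words)" using fin by auto
  then show "\<exists>c. \<forall>T :: nat pair_pre_digraph. c_hassle c T \<and> K_free t T \<longrightarrow>
     (\<exists>H \<in> \<H>. \<forall>C \<in> pre_digraph.sccs (with_proj H). contains (with_proj T) C)"
  \<comment> \<open>The index \<open>(w, k)\<close> stands for offset \<open>k\<close> in the chosen
    occurrence of the word \<open>w\<close>; a walk is labelled by its graph from the family and its
    set of windows.\<close>
  proof (rule ramsey_anticomplete[where ?'v = nat and t = t and M = h], goal_cases)
    case (1 N)
    note N = this
    \<comment> \<open>The summand \<open>c\<close> gives the margins of the tassel, \<open>h\<close>
      makes windows of length \<open>h\<close> exist and be induced paths, and \<open>N\<close>
      supplies enough walks.\<close>
    define d where "d = c + h + N"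
    show ?case
    proof (intro exI[of _ d] allI impI, elim conjE)
      fix T :: "nat pair_pre_digraph" assume "c_hassle d T" and free: "K_free t T"
      then obtain m W n \<phi> x where T: "pair_graph T" and dm: "d \<le> m"
        and walks: "\<forall>i<m. is_walk (W i) (n i) (\<phi> i) \<and> c_stretched d (W i) (n i) (\<phi> i)"
        and disj: "\<forall>i<m. \<forall>j<m. i \<noteq> j \<longrightarrow> pverts (W i) \<inter> pverts (W j) = {}"
        and x_notin: "\<forall>i<m. x \<notin> pverts (W i)"
        and verts: "pverts T = insert x (\<Union>i < m. pverts (W i))"
        and ind: "\<forall>i<m. with_proj T \<restriction> pverts (W i) = with_proj (W i)"
        and nbr: "\<forall>i < m. \<exists>v \<in> pverts (W i). (x, v) \<in> parcs T"
        and far: "\<forall>i < m. \<forall>v \<in> first_verts d (n i) (\<phi> i) \<union> last_verts d (n i) (\<phi> i). (x, v) \<notin> parcs T"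
        unfolding c_hassle_def by (elim conjE exE)
      interpret T: pair_graph T by (rule T)
      have symT: "(u, v) \<in> parcs T \<longleftrightarrow> (v, u) \<in> parcs T" for u v
        using T.pair_sym_arcs by (auto simp: symmetric_def dest: symD)
      have Nm: "i < m" if "i < N" for i using that dm by (simp add: d_def)
      have walk_verts: "pverts (W i) = \<phi> i ` {1..n i}" if "i < m" for i
        using walks that by (simp add: is_walk_def)
      \<comment> \<open>Positions, not vertices, are recorded: the walk is unrolled into a path, and
        a vertex visited repeatedly may count several times.\<close>
      define A where "A i = {k. k < n i \<and> (x, \<phi> i (k + 1)) \<in> parcs T}" for i
      have margin: "d \<le> k \<and> k + d < n i" if "i < m" "k \<in> A i" for i k
      proof (rule ccontr)
        assume "\<not> (d \<le> k \<and> k + d < n i)"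
        then have "\<phi> i (k + 1) \<in> first_verts d (n i) (\<phi> i) \<union> last_verts d (n i) (\<phi> i)"
          using that(2) by (auto simp: first_verts_def last_verts_def A_def intro!: imageI)
        then show False using far that by (auto simp: A_def)
      qed
      have A_ne: "A i \<noteq> {}" if i: "i < m" for i
      proof -
        obtain k where "k \<in> {1..n i}" "(x, \<phi> i k) \<in> parcs T"
          using nbr i unfolding walk_verts[OF i, symmetric] by (metis imageE walk_verts)
        then have "k - 1 \<in> A i" by (auto simp: A_def)
        then show ?thesis by blast
      qed
      have hn: "h \<le> n i" if i: "i < m" for i
      proof -
        obtain k where "k \<in> A i" using A_ne[OF i] by blast
        then show ?thesis using margin[OF i, of k] by (simp add: d_def)
      qed
      have A_sub: "A i \<subseteq> {..<n i}" for i by (auto simp: A_def)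
      \<comment> \<open>\<open>Suc c\<close> copies are at least \<open>c\<close> and at least
        one.\<close>
      have "\<exists>H \<in> \<H>. \<forall>C \<in> pre_digraph.sccs (with_proj H).
          contains (with_proj (standard_tassel (Suc c) (n i) (A i))) C" if "i < m" for i
      proof (intro c c_tassel_standard_tassel)
        show "A i \<noteq> {}" by (rule A_ne[OF that])
        show "c \<le> k \<and> k + c < n i" if "k \<in> A i" for k
          using margin[OF \<open>i < m\<close> that] by (simp add: d_def)
      qed simp_all
      then obtain H where H: "\<And>i. i < m \<Longrightarrow> H i \<in> \<H>"
        and H_cont: "\<And>i C. i < m \<Longrightarrow> C \<in> pre_digraph.sccs (with_proj (H i)) \<Longrightarrow>
          contains (with_proj (standard_tassel (Suc c) (n i) (A i))) C"
        by metis
      define word where "word i b = map (\<lambda>k. b + k \<in> A i) [0..<h]" for i b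
      define L where "L i = word i ` {..n i - h}" for i
      have word_in: "word i b \<in> words" for i b by (simp add: word_def words_def)
      \<comment> \<open>The default 0 also starts a valid window, so \<open>P i\<close> is defined
        on the same index set for every walk.\<close>
      define occ where "occ i w = (if w \<in> L i then SOME b. b \<le> n i - h \<and> word i b = w else 0)" for i w
      have occ: "word i (occ i w) = w" if "w \<in> L i" for i w
        using that someI_ex[of "\<lambda>b. b \<le> n i - h \<and> word i b = w"] by (auto simp: occ_def L_def)
      have occ_le: "occ i w \<le> n i - h" for i w
        using someI_ex[of "\<lambda>b. b \<le> n i - h \<and> word i b = w"] by (auto simp: occ_def L_def)
      define P where "P i q = \<phi> i (occ i (fst q) + 1 + snd q)" for i q
      have P_in: "P i (w, k) \<in> pverts (W i)" if "i < m" "k < h" for i w k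
        using that occ_le[of i w] hn[OF that(1)] by (auto simp: P_def walk_verts)
      have window: "P i (w, k) = P i (w, l) \<longleftrightarrow> k = l"
        "(P i (w, k), P i (w, l)) \<in> parcs T \<longleftrightarrow> l = k + 1 \<or> k = l + 1"
        if "i < m" "k < h" "l < h" for i w k l
      proof -
        have wi: "is_walk (W i) (n i) (\<phi> i)" "c_stretched d (W i) (n i) (\<phi> i)" using walks that by auto
        have "occ i w + 1 + h \<le> n i + 1" using occ_le[of i w] hn[OF that(1)] by simp
        note win = c_stretched_window[OF wi _ _ this that(2,3)]
        show "P i (w, k) = P i (w, l) \<longleftrightarrow> k = l"
          using win(1) by (simp add: P_def d_def)
        have "(u, v) \<in> parcs T \<longleftrightarrow> (u, v) \<in> parcs (W i)" if "u \<in> pverts (W i)" "v \<in> pverts (W i)" for u v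
        proof -
          have "with_proj T \<restriction> pverts (W i) = with_proj (W i)" using ind \<open>i < m\<close> by blast
          from arg_cong[OF this, of arcs]
          have "parcs (W i) = {e \<in> parcs T. fst e \<in> pverts (W i) \<and> snd e \<in> pverts (W i)}" by simp
          then show ?thesis using that by simp
        qed
        from this[OF P_in P_in] show "(P i (w, k), P i (w, l)) \<in> parcs T \<longleftrightarrow> l = k + 1 \<or> k = l + 1"
          using win(2) that by (simp add: P_def d_def)
      qed
      have P_neck: "(x, P i (w, k)) \<in> parcs T \<longleftrightarrow> occ i w + k \<in> A i" if "i < m" "k < h" for i w k
        using that occ_le[of i w] hn[OF that(1)] by (auto simp: P_def A_def)
      have P_disj: "P i (w, k) \<noteq> P j (w', l)" if "i < m" "j < m" "i \<noteq> j" "k < h" "l < h" for i j w w' k l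
        using P_in[OF that(1,4), of w] P_in[OF that(2,5), of w'] disj that by (metis disjoint_iff)
      have "\<exists>X\<subseteq>{..<N}. card X = h \<and> (\<forall>i\<in>X. \<forall>j\<in>X. (H i, L i) = (H j, L j)) \<and>
          (\<forall>i\<in>X. \<forall>j\<in>X. i \<noteq> j \<longrightarrow>
            (\<forall>p\<in>words \<times> {..<h}. \<forall>q\<in>words \<times> {..<h}. (P i p, P j q) \<notin> parcs T))"
      proof (rule N[where E = "\<lambda>u v. (u, v) \<in> parcs T" and V = "pverts T" and P = P and \<sigma> = "\<lambda>i. (H i, L i)"])
        show "symp (\<lambda>u v. (u, v) \<in> parcs T)" by (rule sympI) (use symT in blast)
        show "P i q \<in> pverts T" if "i < N" "q \<in> words \<times> {..<h}" for i q
          using that P_in[OF Nm[OF that(1)], of "snd q" "fst q"] Nm[OF that(1)] verts by auto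
        show "P i q \<noteq> P j q'"
          if "i < N" "j < N" "i \<noteq> j" "q \<in> words \<times> {..<h}" "q' \<in> words \<times> {..<h}" for i j q q'
          using that P_disj Nm by (metis SigmaE lessThan_iff)
        show "(H i, L i) \<in> \<H> \<times> Pow words" if "i < N" for i
          using that H Nm word_in by (auto simp: L_def)
      qed (fact K_free_no_clique[OF T free] K_free_no_biclique[OF T free])+
      then obtain X where X: "X \<subseteq> {..<N}" "card X = h"
        and same: "\<forall>i\<in>X. \<forall>j\<in>X. (H i, L i) = (H j, L j)"
        and anti: "\<forall>i\<in>X. \<forall>j\<in>X. i \<noteq> j \<longrightarrow>
          (\<forall>p\<in>words \<times> {..<h}. \<forall>q\<in>words \<times> {..<h}. (P i p, P j q) \<notin> parcs T)"
        by (elim exE conjE)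
      have finX: "finite X" using X(1) finite_subset by blast
      have Xm: "i < m" if "i \<in> X" for i using that X(1) Nm by auto
      \<comment> \<open>Any walk in \<open>X\<close> can serve as reference: its tassel contains the
        components that are to be embedded.\<close>
      obtain r where r: "r \<in> X" using X(2) \<open>0 < h\<close> by fastforce
      \<comment> \<open>All walks in \<open>X\<close> have the same windows, so a window of walk
        \<open>r\<close> recurs in walk \<open>i\<close> with the same adjacencies to the
        neck.\<close>
      have occ_word: "occ i (word r b) + k \<in> A i \<longleftrightarrow> b + k \<in> A r" if "i \<in> X" "b \<le> n r - h" "k < h" for i b k
      proof -
        have "word r b \<in> L i" using bspec[OF bspec[OF same that(1)] r] that(2) by (auto simp: L_def)
        then have "word i (occ i (word r b)) ! k = word r b ! k" using occ by simp
        then show ?thesis using that(3) by (simp add: word_def)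
      qed
      show "\<exists>H \<in> \<H>. \<forall>C \<in> pre_digraph.sccs (with_proj H). contains (with_proj T) C"
      proof (intro bexI[of _ "H r"] ballI)
        show "H r \<in> \<H>" using H Xm r by blast
        \<comment> \<open>Components are embedded one at a time, so all of \<open>X\<close> is
          available for each of them.\<close>
        fix C assume C: "C \<in> pre_digraph.sccs (with_proj (H r))"
        interpret Ho: pair_graph "H r" using graphs H Xm r by blast
        have "verts C \<subseteq> pverts (H r)"
          using C by (auto simp: pre_digraph.sccs_def induced_subgraph_def subgraph_def)
        then have finC: "finite (verts C)" and cardC: "card (verts C) \<le> h"
          using Ho.pair_finite_verts finite_subset card_mono h[OF H[OF Xm[OF r]]] by (blast, meson le_trans)
        show "contains (with_proj T) C"
        proof (rule contains_transfer[OF H_cont[OF Xm[OF r] C] finC])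
          show "pair_wf_digraph T" by unfold_locales
          fix V assume V: "V \<subseteq> pverts (standard_tassel (Suc c) (n r) (A r))" "finite V" "card V = card (verts C)"
          show "\<exists>g. inj_on g V \<and> g ` V \<subseteq> pverts T \<and>
            (\<forall>u\<in>V. \<forall>v\<in>V. (u, v) \<in> parcs (standard_tassel (Suc c) (n r) (A r)) \<longleftrightarrow> (g u, g v) \<in> parcs T)"
          \<comment> \<open>\<open>Q i b\<close> runs through the occurrence in walk
            \<open>i\<close> of the word read at position \<open>b\<close> of walk
            \<open>r\<close>.\<close>
          proof (rule tassel_shape.embed_by_runs[OF tassel_shape_standard_tassel[OF A_sub] V(1,2) _ \<open>0 < h\<close> hn[OF Xm[OF r]] finX,
                where Q = "\<lambda>i b k. P i (word r b, k)" and x = x])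
            show "card V \<le> h" using V(3) cardC by simp
            show "h \<le> card X" using X(2) by simp
            show "x \<in> pverts T" by (simp add: verts)
            show "(x, x) \<notin> parcs T" using T.pair_no_loops[of "(x, x)"] by auto
            show "P i (word r b, k) \<in> pverts T - {x}" if "i \<in> X" "k < h" for i b k
              using P_in[OF Xm[OF that(1)] that(2)] x_notin Xm[OF that(1)] verts by auto
            show "(x, P i (word r b, k)) \<in> parcs T \<longleftrightarrow> b + k \<in> A r" if "i \<in> X" "b \<le> n r - h" "k < h" for i b k
              using P_neck[OF Xm[OF that(1)] that(3)] occ_word[OF that] by simp
            then show "(P i (word r b, k), x) \<in> parcs T \<longleftrightarrow> b + k \<in> A r" if "i \<in> X" "b \<le> n r - h" "k < h" for i b k
              using that symT by blast
            show "P i (word r b, k) = P i (word r b, l) \<longleftrightarrow> k = l" if "i \<in> X" "k < h" "l < h" for i b k l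
              using window(1)[OF Xm[OF that(1)] that(2,3)] .
            show "(P i (word r b, k), P i (word r b, l)) \<in> parcs T \<longleftrightarrow> l = k + 1 \<or> k = l + 1"
              if "i \<in> X" "k < h" "l < h" for i b k l
              using window(2)[OF Xm[OF that(1)] that(2,3)] .
            show "P i (word r b, k) \<noteq> P j (word r b', l) \<and> (P i (word r b, k), P j (word r b', l)) \<notin> parcs T"
              if "i \<in> X" "j \<in> X" "i \<noteq> j" "k < h" "l < h" for i j b b' k l
              using P_disj[OF Xm[OF that(1)] Xm[OF that(2)] that(3-5)]
                bspec[OF bspec[OF anti that(1)] that(2)] that(3-5) word_in by simp
          qed
        qed
      qed
    qed
  qed
qed

theorem theorem2p1:
  fixes \<H> :: "'a pair_pre_digraph set"
  assumes "finite \<H>" and "\<And>H. H \<in> \<H> \<Longrightarrow> pair_graph H"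
  shows "tasselled \<H> \<longleftrightarrow> hassled \<H>"
  using tasselled_imp_hassled[OF assms] hassled_imp_tasselled by blast

end
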